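(* Let $\varphi_1\colon 2^{S_1}\to\mathbb{R}$ and $\varphi_2\colon 2^{S_2}\to\mathbb{R}$ be polymatroid functions. For subsets $A_1,\dots,A_7\subseteq S_1$ and $B_1,\dots,B_7\subseteq S_2$ write $A_{i_1\dots i_m}=\bigcup_{j=1}^m A_{i_j}$ and $B_{i_1\dots i_m}=\bigcup_{j=1}^m B_{i_j}$ for $\{i_1,\dots,i_m\}\subseteq\{1,\dots,7\}$. (a) If $k\cdot\varphi_2$ is representable over a skew field of characteristic $2$ for some positive integer $k$, then for any subsets $B_1,\dots,B_7\subseteq S_2$, $$\begin{aligned}&\varphi_2(B_4)+\varphi_2(B_6)+\varphi_2(B_{234})+\varphi_2(B_{135})+\varphi_2(B_{126})+\varphi_2(B_{367})+\varphi_2(B_{147})+\varphi_2(B_{257})\\ \ge\ &\varphi_2(B_{36})+\varphi_2(B_{14})+\varphi_2(B_{27})+\varphi_2(B_{456})+\varphi_2(B_{12347})+\varphi_2(B_{123567}).\end{aligned}$$ Moreover, this inequality is violated if $\varphi_2$ is the rank function of the non-Fano matroid $F_7^-$ and $B_i=\{t_i\}$ for $i\in\{1,\dots,7\}$. (b) If $k\cdot\varphi_1$ is representable over a skew field of characteristic different from $2$ for some positive integer $k$, then for any subsets $A_1,\dots,A_7\subseteq S_1$, $$\begin{aligned}&\varphi_1(A_4)+\varphi_1(A_6)+\varphi_1(A_{126})+\varphi_1(A_{135})+\varphi_1(A_{234})+\varphi_1(A_{367})+\varphi_1(A_{147})+\varphi_1(A_{456})+\varphi_1(A_{257})\\ \ge\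 &\varphi_1(A_{36})+\varphi_1(A_{14})+\varphi_1(A_{46})+\varphi_1(A_{25})+\varphi_1(A_{4567})+\varphi_1(A_{12347})+\varphi_1(A_{123567}).\end{aligned}$$ Moreover, this inequality is violated if $\varphi_1$ is the rank function of the Fano matroid $F_7$ and $A_i=\{s_i\}$ for $i\in\{1,\dots,7\}$.
   Context: Ground sets are finite. A polymatroid function is a set function $\varphi\colon 2^S\to\mathbb{R}$ that is increasing, submodular, and satisfies $\varphi(\emptyset)=0$. An integer-valued polymatroid function $\varphi\colon 2^S\to\mathbb{Z}$ is representable over a skew field (division ring) $\mathbb{F}$ if there is a family $(V_s)_{s\in S}$ of subspaces of a right vector space over $\mathbb{F}$ such that for each $X\subseteq S$, $\varphi(X)$ equals the dimension of the span of $\bigcup_{s\in X}V_s$. The Fano matroid $F_7$ is the simple rank-$3$ matroid on $\{s_1,\dots,s_7\}$ whose lines (rank-$2$ flats) with at least three elements are $\{s_1,s_2,s_6\}$, $\{s_1,s_3,s_5\}$, $\{s_1,s_4,s_7\}$, $\{s_2,s_3,s_4\}$, $\{s_2,s_5,s_7\}$, $\{s_3,s_6,s_7\}$, $\{s_4,s_5,s_6\}$. The non-Fano matroid $F_7^-$ is the simple rank-$3$ matroid on $\{t_1,\dots,t_7\}$ whose lines with at least three elements are $\{t_1,t_2,t_6\}$, $\{t_1,t_3,t_5\}$, $\{t_1,t_4,t_7\}$, $\{t_2,t_3,t_4\}$, $\{t_2,t_5,t_7\}$, $\{t_3,t_6,t_7\}$. *)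

theory Defs
  imports Complex_Main
begin

section \<open>Polymatroid functions\<close>

text \<open>The values of a set function outside \<^term>\<open>Pow S\<close> are irrelevant.\<close>

definition polymatroid :: "'s set \<Rightarrow> ('s set \<Rightarrow> real) \<Rightarrow> bool" where
  "polymatroid S \<phi> \<longleftrightarrow>
     finite S \<and>
     \<phi> {} = 0 \<and>
     (\<forall>X Y. X \<subseteq> Y \<and> Y \<subseteq> S \<longrightarrow> \<phi> X \<le> \<phi> Y) \<and>
     (\<forall>X Y. X \<subseteq> S \<and> Y \<subseteq> S \<longrightarrow> \<phi> (X \<union> Y) + \<phi> (X \<inter> Y) \<le> \<phi> X + \<phi> Y)"


section \<open>Right vector spaces over skew fields\<close>

text \<open>
  The library's locale \<^locale>\<open>vector_space\<close> requires a commutative field, so the notions needed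
  over a skew field (type class \<^class>\<open>division_ring\<close>) are set up here, following the
  library's definitions.
\<close>

locale right_vector_space =
  fixes scale :: "'v::ab_group_add \<Rightarrow> 'f::division_ring \<Rightarrow> 'v"  (infixl \<open>\<cdot>\<close> 75)
  assumes scale_left_distrib: "(x + y) \<cdot> a = x \<cdot> a + y \<cdot> a"
    and scale_right_distrib: "x \<cdot> (a + b) = x \<cdot> a + x \<cdot> b"
    and scale_scale: "x \<cdot> (a * b) = x \<cdot> a \<cdot> b"
    and scale_one: "x \<cdot> 1 = x"
begin

definition subspace :: "'v set \<Rightarrow> bool" where
  "subspace W \<longleftrightarrow> 0 \<in> W \<and> (\<forall>x\<in>W. \<forall>y\<in>W. x + y \<in> W) \<and> (\<forall>x\<in>W. \<forall>a. x \<cdot> a \<in> W)"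

definition span :: "'v set \<Rightarrow> 'v set" where
  "span X = subspace hull X"

definition independent :: "'v set \<Rightarrow> bool" where
  "independent B \<longleftrightarrow>
     (\<forall>T u. finite T \<and> T \<subseteq> B \<and> (\<Sum>v\<in>T. v \<cdot> u v) = 0 \<longrightarrow> (\<forall>v\<in>T. u v = 0))"

text \<open>
  A relation rather than a function into \<^typ>\<open>nat\<close>, so that an infinite-dimensional subspace has
  no dimension instead of the dummy dimension \<open>0\<close>.
\<close>

definition has_dimension :: "'v set \<Rightarrow> nat \<Rightarrow> bool" where
  "has_dimension W n \<longleftrightarrow> (\<exists>B. finite B \<and> independent B \<and> span B = W \<and> card B = n)"

end

text \<open>
  Representability over the skew field \<^typ>\<open>'f\<close> by subspaces of a right vector space whose
  underlying additive group is \<^typ>\<open>'v\<close>.  HOL cannot quantify existentially over types, so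
  \<^typ>\<open>'v\<close> is an explicit argument; a theorem with representability as a hypothesis and free
  \<^typ>\<open>'f\<close>, \<^typ>\<open>'v\<close> covers all skew fields and all right vector spaces over them.
  Integrality of the values of \<open>\<phi>\<close> is part of the condition, since they are dimensions.
\<close>

definition representable_over ::
  "'f::division_ring itself \<Rightarrow> 'v::ab_group_add itself \<Rightarrow> 's set \<Rightarrow> ('s set \<Rightarrow> real) \<Rightarrow> bool" where
  "representable_over _ _ S \<phi> \<longleftrightarrow>
     (\<exists>(scale :: 'v \<Rightarrow> 'f \<Rightarrow> 'v) V.
        right_vector_space scale \<and>
        (\<forall>s\<in>S. right_vector_space.subspace scale (V s)) \<and>
        (\<forall>X\<subseteq>S. \<exists>n. right_vector_space.has_dimension scale
                        (right_vector_space.span scale (\<Union>s\<in>X. V s)) n \<and>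
                     \<phi> X = real n))"


section \<open>Matroids\<close>

definition matroid :: "'s set \<Rightarrow> ('s set \<Rightarrow> bool) \<Rightarrow> bool" where
  "matroid S indep \<longleftrightarrow>
     finite S \<and>
     (\<forall>I. indep I \<longrightarrow> I \<subseteq> S) \<and>
     indep {} \<and>
     (\<forall>I J. indep J \<and> I \<subseteq> J \<longrightarrow> indep I) \<and>
     (\<forall>I J. indep I \<and> indep J \<and> card I < card J \<longrightarrow> (\<exists>x\<in>J - I. indep (insert x I)))"

definition matroid_rank :: "('s set \<Rightarrow> bool) \<Rightarrow> 's set \<Rightarrow> nat" where
  "matroid_rank indep X = Max (card ` {I. I \<subseteq> X \<and> indep I})"

text \<open>Simple: no loops and no parallel pairs.\<close>

definition simple_matroid :: "'s set \<Rightarrow> ('s set \<Rightarrow> bool) \<Rightarrow> bool" where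
  "simple_matroid S indep \<longleftrightarrow>
     matroid S indep \<and> (\<forall>x\<in>S. indep {x}) \<and> (\<forall>x\<in>S. \<forall>y\<in>S. x \<noteq> y \<longrightarrow> indep {x, y})"

definition flat :: "'s set \<Rightarrow> ('s set \<Rightarrow> bool) \<Rightarrow> 's set \<Rightarrow> bool" where
  "flat S indep F \<longleftrightarrow>
     F \<subseteq> S \<and> (\<forall>x\<in>S - F. matroid_rank indep F < matroid_rank indep (insert x F))"

definition line :: "'s set \<Rightarrow> ('s set \<Rightarrow> bool) \<Rightarrow> 's set \<Rightarrow> bool" where
  "line S indep L \<longleftrightarrow> flat S indep L \<and> matroid_rank indep L = 2"


subsection \<open>The Fano and the non-Fano matroid\<close>

definition fano_lines :: "nat set set" where
  "fano_lines = {{1,2,6}, {1,3,5}, {1,4,7}, {2,3,4}, {2,5,7}, {3,6,7}, {4,5,6}}"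

definition non_fano_lines :: "nat set set" where
  "non_fano_lines = {{1,2,6}, {1,3,5}, {1,4,7}, {2,3,4}, {2,5,7}, {3,6,7}}"

text \<open>
  \<open>S = {s 1, \<dots>, s 7}\<close> carries a simple matroid of rank 3 whose lines with at least three
  elements are those listed, as sets of indices, in \<open>\<L>\<close>.
\<close>

definition seven_point_plane ::
  "nat set set \<Rightarrow> 's set \<Rightarrow> ('s set \<Rightarrow> bool) \<Rightarrow> (nat \<Rightarrow> 's) \<Rightarrow> bool" where
  "seven_point_plane \<L> S indep s \<longleftrightarrow>
     bij_betw s {1..7} S \<and>
     simple_matroid S indep \<and>
     matroid_rank indep S = 3 \<and>
     {L. line S indep L \<and> 3 \<le> card L} = (\<lambda>J. s ` J) ` \<L>"

definition fano_matroid :: "'s set \<Rightarrow> ('s set \<Rightarrow> bool) \<Rightarrow> (nat \<Rightarrow> 's) \<Rightarrow> bool" where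
  "fano_matroid = seven_point_plane fano_lines"

definition non_fano_matroid :: "'s set \<Rightarrow> ('s set \<Rightarrow> bool) \<Rightarrow> (nat \<Rightarrow> 's) \<Rightarrow> bool" where
  "non_fano_matroid = seven_point_plane non_fano_lines"

text \<open>Both matroids exist:\<close>

lemma seven_point_plane_exists:
  fixes \<L> :: "nat set set"
  defines "indep \<equiv> \<lambda>I. I \<subseteq> {1..7} \<and> card I \<le> 3 \<and> I \<notin> \<L>"
  assumes lines: "\<And>L. L \<in> \<L> \<Longrightarrow> L \<subseteq> {1..7} \<and> card L = 3"
    and card_Int: "\<And>L M. L \<in> \<L> \<Longrightarrow> M \<in> \<L> \<Longrightarrow> L = M \<or> card (L \<inter> M) \<le> 1"
    and "{1,2,3} \<notin> \<L>"
  shows "seven_point_plane \<L> {1..7} indep id"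
proof -
  have meet: "L = M"
    if "L \<in> \<L>" "M \<in> \<L>" "a \<in> L" "b \<in> L" "a \<in> M" "b \<in> M" "a \<noteq> b" for L M a b
  proof -
    have "finite (L \<inter> M)" using lines[of L] that(1) by (auto intro: finite_subset)
    then have "card {a, b} \<le> card (L \<inter> M)" using that by (intro card_mono) auto
    then show ?thesis using card_Int[of L M] that by auto
  qed
  have fin: "finite I" if "indep I" for I
    using that finite_subset unfolding indep_def by blast
  have small: "indep I" if "I \<subseteq> {1..7}" "card I \<le> 2" for I
    using that lines[of I] unfolding indep_def by fastforce
  have mat: "matroid {1..7} indep"
    unfolding matroid_def
  proof (intro conjI allI impI)
    show "indep {}" by (rule small) auto
  next
    fix I J assume *: "indep J \<and> I \<subseteq> J"
    show "indep I"
    proof (cases "I = J")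
      case False
      then have "card I < card J" using * fin[of J] by (simp add: psubset_card_mono psubsetI)
      then show ?thesis using * small[of I] unfolding indep_def by auto
    qed (use * in simp)
  next
    fix I J assume *: "indep I \<and> indep J \<and> card I < card J"
    have fI: "finite I" and fJ: "finite J" using * fin by auto
    have ne: "J - I \<noteq> {}" using * fI by (metis Diff_eq_empty_iff card_mono leD)
    show "\<exists>x\<in>J - I. indep (insert x I)"
    proof (cases "card I \<le> 1")
      case True
      obtain x where x: "x \<in> J - I" using ne by blast
      have "indep (insert x I)"
        by (rule small) (use * x True fI in \<open>auto simp: indep_def\<close>)
      then show ?thesis using x by blast
    next
      case False
      then have c: "card I = 2" "card J = 3" using * unfolding indep_def by auto
      obtain a b where ab: "I = {a,b}" "a \<noteq> b" using c by (auto simp: card_2_iff)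
      show ?thesis
      proof (rule ccontr)
        assume neg: "\<not> ?thesis"
        have L: "insert x I \<in> \<L>" if "x \<in> J - I" for x
          using neg that * c fI unfolding indep_def by auto
        obtain x where x: "x \<in> J - I" using ne by blast
        have "y \<in> insert x I" if "y \<in> J" for y
          using meet[of "insert x I" "insert y I" a b] L that x ab by blast
        then have "J \<subseteq> insert x I" by blast
        moreover have "card (insert x I) = 3" using x c fI by simp
        ultimately have "J = insert x I" using c fI by (intro card_subset_eq) auto
        then show False using L[OF x] * unfolding indep_def by simp
      qed
    qed
  qed (auto simp: indep_def)
  have fs: "finite {I. I \<subseteq> X \<and> indep I}" for X
    by (rule finite_subset[of _ "Pow {1..7}"]) (auto simp: indep_def)
  have nes: "{I. I \<subseteq> X \<and> indep I} \<noteq> {}" for X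
    using small[of "{}"] by auto
  have ge: "card I \<le> matroid_rank indep X" if "I \<subseteq> X" "indep I" for I X
    unfolding matroid_rank_def using that fs by (intro Max_ge) auto
  have le: "matroid_rank indep X \<le> n" if "\<And>I. I \<subseteq> X \<Longrightarrow> indep I \<Longrightarrow> card I \<le> n" for X n
    unfolding matroid_rank_def using that fs[of X] nes[of X] by (subst Max_le_iff) auto
  have simple: "simple_matroid {1..7} indep"
    unfolding simple_matroid_def using mat small by (auto simp: card_insert_if)
  have rank3: "matroid_rank indep {1..7} = 3"
  proof (rule antisym)
    show "matroid_rank indep {1..7} \<le> 3" by (rule le) (simp add: indep_def)
    have "indep {1,2,3}" using assms(4) unfolding indep_def by auto
    from ge[OF _ this, of "{1..7}"] show "3 \<le> matroid_rank indep {1..7}" by auto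
  qed
  have triple: "{a,b,c} \<in> \<L>"
    if "matroid_rank indep X \<le> 2" "{a,b,c} \<subseteq> X" "X \<subseteq> {1..7}" "a \<noteq> b" "a \<noteq> c" "b \<noteq> c" for a b c X
  proof (rule ccontr)
    assume "\<not> ?thesis"
    then have "indep {a,b,c}" using that unfolding indep_def by auto
    from ge[OF that(2) this] that show False by auto
  qed
  have "line {1..7} indep L \<and> 3 \<le> card L \<longleftrightarrow> L \<in> \<L>" for L
  proof
    assume l: "line {1..7} indep L \<and> 3 \<le> card L"
    then have sub: "L \<subseteq> {1..7}" and r: "matroid_rank indep L \<le> 2"
      unfolding line_def flat_def by auto
    obtain T where T: "T \<subseteq> L" "card T = 3" using l obtain_subset_with_card_n by metis
    then obtain a b c where abc: "T = {a,b,c}" "a \<noteq> b" "a \<noteq> c" "b \<noteq> c"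
      by (auto simp: card_3_iff)
    have TL: "T \<in> \<L>" using triple[OF r] T abc sub by blast
    have "d \<in> T" if "d \<in> L" for d
    proof (rule ccontr)
      assume d: "d \<notin> T"
      then have "{a,b,d} \<in> \<L>" using triple[OF r, of a b d] T abc sub that by blast
      then have "{a,b,d} = T" using meet[OF _ TL, of "{a,b,d}" a b] abc by blast
      then show False using d by blast
    qed
    then show "L \<in> \<L>" using T TL by (metis subsetI subset_antisym)
  next
    assume L: "L \<in> \<L>"
    then have sub: "L \<subseteq> {1..7}" and c3: "card L = 3" using lines by auto
    then obtain a b c where abc: "L = {a,b,c}" "a \<noteq> b" "a \<noteq> c" "b \<noteq> c"
      by (auto simp: card_3_iff)
    have r: "matroid_rank indep L = 2"
    proof (rule antisym)
      show "matroid_rank indep L \<le> 2"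
      proof (rule le)
        fix I assume I: "I \<subseteq> L" "indep I"
        then have "I \<noteq> L" using L unfolding indep_def by auto
        then have "card I < card L" using I abc by (intro psubset_card_mono) auto
        then show "card I \<le> 2" using c3 by simp
      qed
      have "indep {a,b}" by (rule small) (use abc sub in auto)
      from ge[OF _ this, of L] show "2 \<le> matroid_rank indep L" using abc by auto
    qed
    have "2 < matroid_rank indep (insert x L)" if x: "x \<in> {1..7} - L" for x
    proof -
      have "{a,b,x} \<notin> \<L>" using meet[OF L, of "{a,b,x}" a b] abc x by blast
      then have "indep {a,b,x}" using sub abc x unfolding indep_def by auto
      from ge[OF _ this, of "insert x L"] show ?thesis using abc x by auto
    qed
    then show "line {1..7} indep L \<and> 3 \<le> card L"
      unfolding line_def flat_def using sub r c3 by auto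
  qed
  then show ?thesis
    unfolding seven_point_plane_def using simple rank3 by auto
qed

lemma fano_matroid_exists:
  "fano_matroid {1..7} (\<lambda>I. I \<subseteq> {1..7} \<and> card I \<le> 3 \<and> I \<notin> fano_lines) id"
  unfolding fano_matroid_def
proof (rule seven_point_plane_exists)
  have "\<forall>L\<in>fano_lines. L \<subseteq> {1..7} \<and> card L = 3" by code_simp
  then show "L \<subseteq> {1..7} \<and> card L = 3" if "L \<in> fano_lines" for L using that by blast
  have "\<forall>L\<in>fano_lines. \<forall>M\<in>fano_lines. L = M \<or> card (L \<inter> M) \<le> 1" by code_simp
  then show "L = M \<or> card (L \<inter> M) \<le> 1" if "L \<in> fano_lines" "M \<in> fano_lines" for L M
    using that by blast
  show "{1,2,3} \<notin> fano_lines" by code_simp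
qed

lemma non_fano_matroid_exists:
  "non_fano_matroid {1..7} (\<lambda>I. I \<subseteq> {1..7} \<and> card I \<le> 3 \<and> I \<notin> non_fano_lines) id"
  unfolding non_fano_matroid_def
proof (rule seven_point_plane_exists)
  have "\<forall>L\<in>non_fano_lines. L \<subseteq> {1..7} \<and> card L = 3" by code_simp
  then show "L \<subseteq> {1..7} \<and> card L = 3" if "L \<in> non_fano_lines" for L using that by blast
  have "\<forall>L\<in>non_fano_lines. \<forall>M\<in>non_fano_lines. L = M \<or> card (L \<inter> M) \<le> 1" by code_simp
  then show "L = M \<or> card (L \<inter> M) \<le> 1" if "L \<in> non_fano_lines" "M \<in> non_fano_lines" for L M
    using that by blast
  show "{1,2,3} \<notin> non_fano_lines" by code_simp
qed

section \<open>The two inequalities\<close>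

definition char_2_inequality :: "('s set \<Rightarrow> real) \<Rightarrow> (nat \<Rightarrow> 's set) \<Rightarrow> bool" where
  "char_2_inequality \<phi> B \<longleftrightarrow>
     (let b = (\<lambda>J. \<phi> (\<Union>j\<in>J. B j)) in
        b {4} + b {6} + b {2,3,4} + b {1,3,5} + b {1,2,6} + b {3,6,7} + b {1,4,7} + b {2,5,7}
        \<ge> b {3,6} + b {1,4} + b {2,7} + b {4,5,6} + b {1,2,3,4,7} + b {1,2,3,5,6,7})"

definition char_not_2_inequality :: "('s set \<Rightarrow> real) \<Rightarrow> (nat \<Rightarrow> 's set) \<Rightarrow> bool" where
  "char_not_2_inequality \<phi> A \<longleftrightarrow>
     (let a = (\<lambda>J. \<phi> (\<Union>j\<in>J. A j)) in
        a {4} + a {6} + a {1,2,6} + a {1,3,5} + a {2,3,4} + a {3,6,7} + a {1,4,7} + a {4,5,6}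
          + a {2,5,7}
        \<ge> a {3,6} + a {1,4} + a {4,6} + a {2,5} + a {4,5,6,7} + a {1,2,3,4,7}
          + a {1,2,3,5,6,7})"

end

theory Submission
  imports Defs
begin

text \<open>
  Both inequalities come from one family of vector configurations. Let \<open>V 1, \<dots>, V 7\<close> be the
  subspaces representing the seven sets, and consider vectors \<open>x i \<in> V i\<close> with
  \<open>x 7 = x 2 + x 5 = x 3 + x 6 = x 1 + x 4\<close> and \<open>x 6 = x 1 + x 2\<close>.
  They are linearly dependent along each of the six lines common to both planes. Adding up,
  \<open>x 4 + x 5 + x 6 = 2 x 7\<close>. So the seventh line \<open>{4, 5, 6}\<close> is decided by the characteristic: in
  characteristic 2, \<open>x 5\<close> lies in \<open>V 4 + V 6\<close>; in any other, \<open>x 7\<close> lies in \<open>V 4 + V 5 + V 6\<close>.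

  The inequalities count dimensions along this argument. Start from all configurations with
  \<open>x 7 = x 2 + x 5\<close> and observe a single coordinate, \<open>x 5\<close> in characteristic 2 and \<open>x 7\<close> otherwise.
  Each further condition demands that a linear expression already known to lie in a subspace \<open>W\<close>
  falls into a smaller one \<open>W'\<close>, and so lowers the dimension of the space of observed values by at
  most \<open>dim W - dim W'\<close> (\<open>dim_restrict\<close>). What makes the total cost as small as the inequalities
  assert is the choice of \<open>W\<close>: conditions imposed earlier confine the expression.
  The sum of the costs is computed with the modular law (\<open>dim_join\<close>), which gives
  \<open>dim_fano_configurations\<close>; comparing the first and the last space of observed values with
  intersections of sums of the \<open>V i\<close> gives the two dimension inequalities, and subadditivity
  of the polymatroid function on the fourth and the sixth set gives the form with the two single
  terms.

  For the violations, only the ranks of few sets matter. Points have rank at most 1,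
  two distinct points together have rank 2, and so do listed lines, while a set with at least three
  elements contained in no listed line has rank at least 3, since a maximal rank-2 superset of it would be a line.
\<close>

section \<open>Span and exchange over a skew field\<close>

context right_vector_space
begin

lemma scale_zero_right [simp]: "x \<cdot> 0 = 0"
  using scale_right_distrib[of x 0 0] by simp

lemma scale_zero_left [simp]: "0 \<cdot> a = 0"
  using scale_left_distrib[of 0 0 a] by simp

lemma scale_minus_left: "(- x) \<cdot> a = - (x \<cdot> a)"
  using scale_left_distrib[of x "- x" a] by (simp add: eq_neg_iff_add_eq_0 add.commute)

lemma scale_minus_right: "x \<cdot> (- a) = - (x \<cdot> a)"
  using scale_right_distrib[of x a "- a"] by (simp add: eq_neg_iff_add_eq_0 add.commute)

lemma scale_diff_left: "(x - y) \<cdot> a = x \<cdot> a - y \<cdot> a"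
  using scale_left_distrib[of x "- y" a] by (simp add: scale_minus_left)

lemma subspace_0: "subspace W \<Longrightarrow> 0 \<in> W"
  and subspace_add: "subspace W \<Longrightarrow> x \<in> W \<Longrightarrow> y \<in> W \<Longrightarrow> x + y \<in> W"
  and subspace_scale: "subspace W \<Longrightarrow> x \<in> W \<Longrightarrow> x \<cdot> a \<in> W"
  unfolding subspace_def by auto

lemma subspace_neg: "subspace W \<Longrightarrow> x \<in> W \<Longrightarrow> - x \<in> W"
  using subspace_scale[of W x "- 1"] by (simp add: scale_minus_right scale_one)

lemma subspace_diff: "subspace W \<Longrightarrow> x \<in> W \<Longrightarrow> y \<in> W \<Longrightarrow> x - y \<in> W"
  using subspace_add[of W x "- y"] subspace_neg[of W y] by simp

lemma subspace_Int: "subspace A \<Longrightarrow> subspace B \<Longrightarrow> subspace (A \<inter> B)"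
  unfolding subspace_def by auto

lemma subspace_span: "subspace (span X)"
  unfolding span_def by (rule hull_in) (auto simp: subspace_def)

lemma span_superset: "X \<subseteq> span X"
  unfolding span_def by (rule hull_subset)

lemma span_minimal: "X \<subseteq> W \<Longrightarrow> subspace W \<Longrightarrow> span X \<subseteq> W"
  unfolding span_def by (rule hull_minimal)

lemma span_mono: "X \<subseteq> Y \<Longrightarrow> span X \<subseteq> span Y"
  unfolding span_def by (rule hull_mono)

lemma span_subspace: "subspace W \<Longrightarrow> span W = W"
  using span_minimal[of W W] span_superset[of W] by auto

lemma span_empty: "span {} = {0}"
  using span_minimal[of "{}" "{0}"] subspace_0[OF subspace_span, of "{}"]
  by (auto simp: subspace_def)

lemma span_subset_span: "X \<subseteq> span Y \<Longrightarrow> span X \<subseteq> span Y"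
  by (rule span_minimal[OF _ subspace_span])

lemma span_insert: "v \<in> span (insert y X) \<longleftrightarrow> (\<exists>c. v - y \<cdot> c \<in> span X)"
proof
  let ?W = "{v. \<exists>c. v - y \<cdot> c \<in> span X}"
  have "subspace ?W"
    unfolding subspace_def
  proof (intro conjI ballI allI)
    show "0 \<in> ?W" by (auto intro!: exI[of _ 0] subspace_0 subspace_span)
  next
    fix v w assume "v \<in> ?W" "w \<in> ?W"
    then obtain c d where "v - y \<cdot> c \<in> span X" "w - y \<cdot> d \<in> span X" by auto
    then have "(v - y \<cdot> c) + (w - y \<cdot> d) \<in> span X" by (rule subspace_add[OF subspace_span])
    then have "(v + w) - y \<cdot> (c + d) \<in> span X"
      by (simp add: scale_right_distrib algebra_simps)
    then show "v + w \<in> ?W" by blast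
  next
    fix v a assume "v \<in> ?W"
    then obtain c where "v - y \<cdot> c \<in> span X" by auto
    then have "(v - y \<cdot> c) \<cdot> a \<in> span X" by (rule subspace_scale[OF subspace_span])
    then have "v \<cdot> a - y \<cdot> (c * a) \<in> span X"
      by (simp add: scale_diff_left scale_scale)
    then show "v \<cdot> a \<in> ?W" by blast
  qed
  moreover have "insert y X \<subseteq> ?W"
  proof
    fix v assume "v \<in> insert y X"
    then show "v \<in> ?W"
    proof
      assume "v = y"
      then show ?thesis
        by (auto intro!: exI[of _ 1] simp: scale_one subspace_0 subspace_span)
    next
      assume "v \<in> X"
      then show ?thesis using span_superset[of X] by (auto intro!: exI[of _ 0])
    qed
  qed
  ultimately have "span (insert y X) \<subseteq> ?W" by (intro span_minimal)
  then show "v \<in> span (insert y X) \<Longrightarrow> \<exists>c. v - y \<cdot> c \<in> span X" by auto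
next
  assume "\<exists>c. v - y \<cdot> c \<in> span X"
  then obtain c where "v - y \<cdot> c \<in> span X" by auto
  then have "v - y \<cdot> c \<in> span (insert y X)" using span_mono[of X "insert y X"] by auto
  moreover have "y \<cdot> c \<in> span (insert y X)"
    using span_superset[of "insert y X"] by (auto intro: subspace_scale[OF subspace_span])
  ultimately have "(v - y \<cdot> c) + y \<cdot> c \<in> span (insert y X)"
    by (rule subspace_add[OF subspace_span])
  then show "v \<in> span (insert y X)" by simp
qed

lemma span_exchange:
  assumes "x \<in> span (insert y X)" and "x \<notin> span X"
  shows "y \<in> span (insert x X)"
proof -
  obtain c where c: "x - y \<cdot> c \<in> span X" using assms span_insert by auto
  have "c \<noteq> 0" using c assms(2) by auto
  then have "y \<cdot> c \<cdot> inverse c = y" by (simp flip: scale_scale add: scale_one)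
  then have "y - x \<cdot> inverse c = - ((x - y \<cdot> c) \<cdot> inverse c)"
    by (simp add: scale_diff_left)
  also have "\<dots> \<in> span X"
    by (intro subspace_neg subspace_scale subspace_span c)
  finally show ?thesis using span_insert by blast
qed

lemma span_finite_combination:
  "finite X \<Longrightarrow> v \<in> span X \<Longrightarrow> \<exists>u. v = (\<Sum>x\<in>X. x \<cdot> u x)"
proof (induction X arbitrary: v rule: finite_induct)
  case empty
  then show ?case by (simp add: span_empty)
next
  case (insert y X)
  then obtain c where "v - y \<cdot> c \<in> span X" using span_insert by auto
  then obtain u where u: "v - y \<cdot> c = (\<Sum>x\<in>X. x \<cdot> u x)" using insert.IH by auto
  have "(\<Sum>x\<in>X. x \<cdot> (u(y := c)) x) = (\<Sum>x\<in>X. x \<cdot> u x)"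
    using insert.hyps by (intro sum.cong) auto
  then have "v = (\<Sum>x\<in>insert y X. x \<cdot> (u(y := c)) x)"
    using insert.hyps u by (simp add: algebra_simps)
  then show ?case by blast
qed

section \<open>Dimension\<close>

text \<open>
  Independence in terms of the closure operator \<^const>\<open>span\<close> alone: the Steinitz argument then
  needs no coefficients, just \<open>span_exchange\<close>.
\<close>

definition irredundant :: "'v set \<Rightarrow> bool" where
  "irredundant I \<longleftrightarrow> (\<forall>v\<in>I. v \<notin> span (I - {v}))"

lemma independent_irredundant:
  assumes "finite B" "independent B"
  shows "irredundant B"
  unfolding irredundant_def
proof (intro ballI notI)
  fix v assume v: "v \<in> B" "v \<in> span (B - {v})"
  then obtain u where u: "v = (\<Sum>x\<in>B - {v}. x \<cdot> u x)"
    using span_finite_combination[of "B - {v}" v] assms(1) by auto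
  have "(\<Sum>x\<in>B. x \<cdot> (u(v := - 1)) x) = v \<cdot> (- 1) + (\<Sum>x\<in>B - {v}. x \<cdot> (u(v := - 1)) x)"
    using v(1) assms(1) by (simp add: sum.remove)
  also have "(\<Sum>x\<in>B - {v}. x \<cdot> (u(v := - 1)) x) = v"
    by (subst (3) u, rule sum.cong) auto
  finally have "(\<Sum>x\<in>B. x \<cdot> (u(v := - 1)) x) = 0"
    by (simp add: scale_minus_right scale_one)
  then have "(u(v := - 1)) v = 0"
    using assms v(1) unfolding independent_def by blast
  then show False by simp
qed

lemma irredundant_insert:
  assumes "irredundant I" "v \<notin> span I"
  shows "irredundant (insert v I)"
  unfolding irredundant_def
proof (intro ballI notI)
  fix w assume w: "w \<in> insert v I" "w \<in> span (insert v I - {w})"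
  show False
  proof (cases "w = v")
    case True
    then show False using w assms(2) span_mono[of "insert v I - {v}" I] by auto
  next
    case False
    then have "w \<in> I" and eq: "insert v I - {w} = insert v (I - {w})" using w by auto
    then have "w \<notin> span (I - {w})" using assms(1) by (auto simp: irredundant_def)
    then have "v \<in> span (insert w (I - {w}))" using span_exchange w(2) eq by metis
    then show False using assms(2) \<open>w \<in> I\<close> by (simp add: insert_absorb)
  qed
qed

text \<open>
  Steinitz: elements of \<open>B - I\<close> are replaced by elements of \<open>I\<close> one at a time. Which element can
  be replaced is read off from a smallest subset of \<open>B\<close> that contains \<open>B \<inter> I\<close> and still
  spans the new element \<open>i\<close>.
\<close>

lemma irredundant_card_le:
  assumes "finite I" "irredundant I" "finite B" "I \<subseteq> span B"
  shows "card I \<le> card B"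
  using assms(3,4)
proof (induction "card (I - B)" arbitrary: B rule: less_induct)
  case less
  show ?case
  proof (cases "I \<subseteq> B")
    case True
    then show ?thesis using less.prems by (simp add: card_mono)
  next
    case False
    then obtain i where i: "i \<in> I" "i \<notin> B" by auto
    let ?P = "\<lambda>C. B \<inter> I \<subseteq> C \<and> C \<subseteq> B \<and> i \<in> span C"
    have "?P B" using i less.prems by auto
    then obtain C where C: "?P C" and min: "\<And>D. ?P D \<Longrightarrow> card C \<le> card D"
      using ex_has_least_nat[of ?P B card] by blast
    have finC: "finite C" using C less.prems(1) finite_subset by blast
    have "i \<notin> span (B \<inter> I)"
      using assms(2) i span_mono[of "B \<inter> I" "I - {i}"] by (auto simp: irredundant_def)
    then have "\<not> C \<subseteq> B \<inter> I" using C span_mono by blast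
    then obtain b where b: "b \<in> C" "b \<notin> I" using C by blast
    have "i \<notin> span (C - {b})"
    proof
      assume "i \<in> span (C - {b})"
      then have "card C \<le> card (C - {b})" using C b by (intro min) auto
      then show False using card_Diff1_less[OF finC b(1)] by linarith
    qed
    moreover have "i \<in> span (insert b (C - {b}))" using C b by (simp add: insert_absorb)
    ultimately have "b \<in> span (insert i (C - {b}))" by (rule span_exchange[rotated])
    moreover let ?B = "insert i (B - {b})"
    have "insert i (C - {b}) \<subseteq> ?B" using C by auto
    ultimately have "b \<in> span ?B" using span_mono by blast
    then have "B \<subseteq> span ?B" using span_superset[of ?B] by blast
    then have "I \<subseteq> span ?B" using less.prems(2) span_subset_span by blast
    moreover have "card (I - ?B) < card (I - B)"
      using i b assms(1) by (intro psubset_card_mono) auto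
    ultimately have "card I \<le> card ?B" using less.hyps less.prems(1) by simp
    also have "card ?B = card B"
      using b C i less.prems(1) by (subst card_insert_disjoint) (auto intro: card_Suc_Diff1)
    finally show ?thesis .
  qed
qed

text \<open>Requiring \<open>W\<close> only to be covered by a finitely generated subspace makes this trivially inherited
  by subsets.\<close>

definition finite_dim :: "'v set \<Rightarrow> bool" where
  "finite_dim W \<longleftrightarrow> (\<exists>B. finite B \<and> W \<subseteq> span B)"

definition basis :: "'v set \<Rightarrow> 'v set \<Rightarrow> bool" where
  "basis I W \<longleftrightarrow> finite I \<and> irredundant I \<and> I \<subseteq> W \<and> W \<subseteq> span I"

definition dim :: "'v set \<Rightarrow> nat" where
  "dim W = card (SOME I. basis I W)"

lemma finite_dim_subset: "A \<subseteq> W \<Longrightarrow> finite_dim W \<Longrightarrow> finite_dim A"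
  unfolding finite_dim_def by blast

lemma basis_exists:
  assumes "finite_dim W"
  shows "\<exists>I. basis I W"
proof -
  obtain B where B: "finite B" "W \<subseteq> span B" using assms finite_dim_def by auto
  let ?P = "\<lambda>I. finite I \<and> irredundant I \<and> I \<subseteq> W"
  have "?P {}" by (auto simp: irredundant_def)
  moreover have "\<And>I. ?P I \<Longrightarrow> card I < Suc (card B)"
    using irredundant_card_le B by (meson le_imp_less_Suc order_trans)
  ultimately obtain I where I: "?P I" and max: "\<And>J. ?P J \<Longrightarrow> card J \<le> card I"
    using ex_has_greatest_nat[of ?P "{}" card "Suc (card B)"] by (metis less_imp_le)
  have "v \<in> span I" if "v \<in> W" for v
  proof (rule ccontr)
    assume v: "v \<notin> span I"
    then have "card (insert v I) \<le> card I"
      using max[of "insert v I"] I that irredundant_insert by auto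
    moreover have "v \<notin> I" using v span_superset by blast
    ultimately show False using I by simp
  qed
  then show ?thesis using I unfolding basis_def by blast
qed

lemma basis_card_le: "basis I A \<Longrightarrow> A \<subseteq> span J \<Longrightarrow> finite J \<Longrightarrow> card I \<le> card J"
  unfolding basis_def by (meson irredundant_card_le order_trans)

lemma dim_eq_card_basis:
  assumes "basis I W" shows "dim W = card I"
proof -
  have "basis (SOME I. basis I W) W" using assms by (rule someI)
  then show ?thesis
    unfolding dim_def using assms by (meson basis_card_le basis_def order_antisym)
qed

lemma has_dimension_dim:
  assumes "has_dimension W n"
  shows "finite_dim W" and "dim W = n"
proof -
  obtain B where B: "finite B" "independent B" "span B = W" "card B = n"
    using assms has_dimension_def by auto
  then show "finite_dim W" unfolding finite_dim_def by blast
  have "basis B W"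
    unfolding basis_def using B independent_irredundant span_superset by auto
  then show "dim W = n" using dim_eq_card_basis B by simp
qed

lemma dim_mono:
  assumes "A \<subseteq> W" "finite_dim W"
  shows "dim A \<le> dim W"
proof -
  obtain I J where I: "basis I A" and J: "basis J W"
    using assms finite_dim_subset basis_exists by meson
  then have "card I \<le> card J" using assms(1) by (intro basis_card_le) (auto simp: basis_def)
  then show ?thesis using I J dim_eq_card_basis by simp
qed

lemma dim_zero: "dim {0} = 0"
  using dim_eq_card_basis[of "{}" "{0}"] by (simp add: basis_def irredundant_def span_empty)

lemma finite_dim_span_insert: "finite_dim W \<Longrightarrow> finite_dim (span (insert v W))"
  unfolding finite_dim_def
proof (elim exE conjE)
  fix B assume "finite B" "W \<subseteq> span B"
  then have "insert v W \<subseteq> span (insert v B)"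
    using span_mono[of B "insert v B"] span_superset[of "insert v B"] by auto
  then have "span (insert v W) \<subseteq> span (insert v B)" by (rule span_subset_span)
  then show "\<exists>B. finite B \<and> span (insert v W) \<subseteq> span B" using \<open>finite B\<close> by blast
qed

lemma dim_span_insert_le:
  assumes "finite_dim W"
  shows "dim (span (insert v W)) \<le> dim W + 1"
proof -
  obtain I where I: "basis I W" using assms basis_exists by auto
  obtain J where J: "basis J (span (insert v W))"
    using assms finite_dim_span_insert basis_exists by meson
  have "insert v W \<subseteq> span (insert v I)"
    using I span_mono[of I "insert v I"] span_superset[of "insert v I"]
    by (auto simp: basis_def)
  then have "card J \<le> card (insert v I)"
    using I by (intro basis_card_le[OF J] span_subset_span) (auto simp: basis_def)
  also have "\<dots> \<le> card I + 1" by (simp add: card_insert_le_m1 card_insert_if)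
  finally show ?thesis using I J dim_eq_card_basis by simp
qed

lemma dim_span_insert:
  assumes "finite_dim W" "subspace W" "v \<notin> W"
  shows "dim (span (insert v W)) = dim W + 1"
proof -
  obtain I where I: "basis I W" using assms basis_exists by auto
  have sub: "W \<subseteq> span (insert v W)" "v \<in> span (insert v W)"
    using span_superset[of "insert v W"] by auto
  have "span I \<subseteq> W" using I assms(2) by (intro span_minimal) (auto simp: basis_def)
  then have "v \<notin> span I" using assms(3) by auto
  then have "irredundant (insert v I)" using I irredundant_insert by (auto simp: basis_def)
  moreover have "insert v W \<subseteq> span (insert v I)"
    using I span_mono[of I "insert v I"] span_superset[of "insert v I"]
    by (auto simp: basis_def)
  then have "span (insert v W) \<subseteq> span (insert v I)" by (rule span_subset_span)
  ultimately have "basis (insert v I) (span (insert v W))"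
    using I sub unfolding basis_def by blast
  then have "dim (span (insert v W)) = card (insert v I)" by (rule dim_eq_card_basis)
  also have "v \<notin> I" using I assms(3) by (auto simp: basis_def)
  then have "card (insert v I) = dim W + 1"
    using I dim_eq_card_basis by (simp add: basis_def)
  finally show ?thesis .
qed

section \<open>Linear families of configurations\<close>

text \<open>
  A configuration assigns a vector to each index, and a linear family is a space of configurations.
  The rank arguments below look only at the values that a linear form takes on such a family.
\<close>

definition linear_family :: "('i \<Rightarrow> 'v) set \<Rightarrow> bool" where
  "linear_family K \<longleftrightarrow>
     (\<lambda>_. 0) \<in> K \<and> (\<forall>x\<in>K. \<forall>y\<in>K. (\<lambda>i. x i + y i) \<in> K) \<and> (\<forall>x\<in>K. \<forall>a. (\<lambda>i. x i \<cdot> a) \<in> K)"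

definition linear_form :: "(('i \<Rightarrow> 'v) \<Rightarrow> 'v) \<Rightarrow> bool" where
  "linear_form f \<longleftrightarrow>
     (\<forall>x y. f (\<lambda>i. x i + y i) = f x + f y) \<and> (\<forall>x a. f (\<lambda>i. x i \<cdot> a) = f x \<cdot> a)"

lemma
  assumes "linear_family K"
  shows linear_family_0: "(\<lambda>_. 0) \<in> K"
    and linear_family_add: "x \<in> K \<Longrightarrow> y \<in> K \<Longrightarrow> (\<lambda>i. x i + y i) \<in> K"
    and linear_family_scale: "x \<in> K \<Longrightarrow> (\<lambda>i. x i \<cdot> a) \<in> K"
  using assms unfolding linear_family_def by auto

lemma
  assumes "linear_form f"
  shows linear_form_add: "f (\<lambda>i. x i + y i) = f x + f y"
    and linear_form_scale: "f (\<lambda>i. x i \<cdot> a) = f x \<cdot> a"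
  using assms unfolding linear_form_def by auto

lemma linear_form_0: "linear_form f \<Longrightarrow> f (\<lambda>_. 0) = 0"
  using linear_form_scale[of f "\<lambda>_. 0" 0] by simp

lemma subspace_image:
  assumes K: "linear_family K" and f: "linear_form f"
  shows "subspace (f ` K)"
  unfolding subspace_def
proof (intro conjI ballI allI)
  show "0 \<in> f ` K"
    by (rule image_eqI[OF _ linear_family_0[OF K]]) (simp add: linear_form_0 f)
next
  fix u v assume "u \<in> f ` K" "v \<in> f ` K"
  then obtain x y where xy: "x \<in> K" "y \<in> K" "u = f x" "v = f y" by auto
  then show "u + v \<in> f ` K"
    by (intro image_eqI[OF _ linear_family_add[OF K xy(1,2)]]) (simp add: linear_form_add f)
next
  fix u a assume "u \<in> f ` K"
  then obtain x where x: "x \<in> K" "u = f x" by auto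
  then show "u \<cdot> a \<in> f ` K"
    by (intro image_eqI[OF _ linear_family_scale[OF K x(1)]]) (simp add: linear_form_scale f)
qed

lemma linear_family_combination:
  "linear_family K \<Longrightarrow> x \<in> K \<Longrightarrow> y \<in> K \<Longrightarrow> (\<lambda>i. x i + y i \<cdot> a) \<in> K"
  by (rule linear_family_add) (auto intro: linear_family_scale)

lemma linear_form_combination:
  "linear_form f \<Longrightarrow> f (\<lambda>i. x i + y i \<cdot> a) = f x + f y \<cdot> a"
  using linear_form_add[of f x "\<lambda>i. y i \<cdot> a"] by (simp add: linear_form_scale)

lemma linear_family_restrict:
  assumes "linear_family K" "linear_form g" "subspace W"
  shows "linear_family {x \<in> K. g x \<in> W}"
  using assms linear_form_0[OF assms(2)]
  unfolding linear_family_def linear_form_def subspace_def by auto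

text \<open>
  Restricting \<open>K\<close> to the configurations with \<open>g x \<in> W'\<close> costs the image under \<open>f\<close> at most
  \<open>dim W - dim W'\<close> dimensions. The reason is that if \<open>W'\<close> is enlarged by one vector \<open>g x\<close>, then the image
  of the restricted family grows at most by the line through \<open>f x\<close>; the induction enlarges \<open>W'\<close> in
  this way until all of \<open>f ` K\<close> is reached.
\<close>

lemma dim_restrict:
  assumes K: "linear_family K" and f: "linear_form f" and g: "linear_form g"
    and W: "finite_dim W" "subspace W" "g ` K \<subseteq> W"
    and fin: "finite_dim (f ` K)"
    and W': "subspace W'" "W' \<subseteq> W"
  shows "dim (f ` K) + dim W' \<le> dim (f ` {x \<in> K. g x \<in> W'}) + dim W"
  using W'
proof (induction "dim W - dim W'" arbitrary: W' rule: less_induct)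
  case less
  let ?A = "f ` {x \<in> K. g x \<in> W'}"
  have fW': "finite_dim W'" using finite_dim_subset less.prems W by auto
  show ?case
  proof (cases "f ` K \<subseteq> ?A")
    case True
    then have "dim (f ` K) \<le> dim ?A"
      by (rule dim_mono) (rule finite_dim_subset[OF _ fin], auto)
    then show ?thesis using dim_mono[OF less.prems(2)] W by simp
  next
    case False
    then obtain x where x: "x \<in> K" "f x \<notin> ?A" by auto
    then have gx: "g x \<notin> W'" by auto
    let ?W = "span (insert (g x) W')"
    have fA: "finite_dim ?A" by (rule finite_dim_subset[OF _ fin]) auto
    have sA: "subspace ?A"
      by (intro subspace_image linear_family_restrict K f g less.prems)
    have W1: "?W \<subseteq> W" using less.prems W x by (intro span_minimal) auto
    have d: "dim ?W = dim W' + 1" using fW' less.prems gx by (intro dim_span_insert)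
    moreover have "dim ?W \<le> dim W" using W1 W by (intro dim_mono)
    ultimately have "dim (f ` K) + dim ?W \<le> dim (f ` {x \<in> K. g x \<in> ?W}) + dim W"
      using W1 by (intro less.hyps subspace_span) auto
    moreover have "f ` {x \<in> K. g x \<in> ?W} \<subseteq> span (insert (f x) ?A)"
    proof clarify
      fix y assume y: "y \<in> K" "g y \<in> ?W"
      then obtain c where c: "g y - g x \<cdot> c \<in> W'"
        using span_insert span_subspace[OF less.prems(1)] by auto
      then have "f (\<lambda>i. y i + x i \<cdot> (- c)) \<in> ?A"
        using linear_family_combination[OF K y(1) x(1), of "- c"]
          linear_form_combination[OF g, of y x "- c"]
        by (intro imageI) (simp add: scale_minus_right)
      then have "f y - f x \<cdot> c \<in> ?A"
        using linear_form_combination[OF f, of y x "- c"] by (simp only: scale_minus_right) simp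
      then show "f y \<in> span (insert (f x) ?A)"
        unfolding span_insert span_subspace[OF sA] by blast
    qed
    then have "dim (f ` {x \<in> K. g x \<in> ?W}) \<le> dim (span (insert (f x) ?A))"
      using fA by (intro dim_mono finite_dim_span_insert)
    ultimately show ?thesis using d dim_span_insert_le[OF fA, of "f x"] by linarith
  qed
qed

lemma span_Un:
  assumes "subspace A" "subspace B"
  shows "span (A \<union> B) = {a + b | a b. a \<in> A \<and> b \<in> B}" (is "_ = ?S")
proof
  have "subspace ?S"
    unfolding subspace_def
  proof (intro conjI ballI allI)
    have "0 = (0 :: 'v) + 0" by simp
    then show "0 \<in> ?S" using subspace_0 assms by blast
  next
    fix x y assume "x \<in> ?S" "y \<in> ?S"
    then obtain a b c d where "x = a + b" "y = c + d" "a \<in> A" "b \<in> B" "c \<in> A" "d \<in> B" by auto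
    moreover from this have "x + y = (a + c) + (b + d)" by (simp add: algebra_simps)
    ultimately show "x + y \<in> ?S" using subspace_add assms by blast
  next
    fix x s assume "x \<in> ?S"
    then show "x \<cdot> s \<in> ?S" using scale_left_distrib subspace_scale assms by blast
  qed
  moreover have "A \<union> B \<subseteq> ?S"
  proof
    fix x assume "x \<in> A \<union> B"
    moreover have "x = x + 0" "x = 0 + x" by simp_all
    ultimately show "x \<in> ?S"
      using subspace_0[OF assms(1)] subspace_0[OF assms(2)] by blast
  qed
  ultimately show "span (A \<union> B) \<subseteq> ?S" by (intro span_minimal)
  show "?S \<subseteq> span (A \<union> B)"
    using span_superset[of "A \<union> B"] by (auto intro!: subspace_add[OF subspace_span])
qed

text \<open>
  The modular law is two instances of the restriction principle: the pairs \<open>(a, b) \<in> A \<times> B\<close>,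
  observed through \<open>a + b\<close>, restricted to \<open>a \<in> A \<inter> B\<close>; and \<open>A\<close>, viewed inside \<open>A + B\<close>, restricted
  to \<open>B\<close>.
\<close>

lemma dim_Int_Un:
  assumes A: "subspace A" and B: "subspace B" and fin: "finite_dim (span (A \<union> B))"
  shows "dim (A \<inter> B) + dim (span (A \<union> B)) = dim A + dim B"
proof (rule antisym)
  have sub: "A \<subseteq> span (A \<union> B)" "B \<subseteq> span (A \<union> B)" using span_superset[of "A \<union> B"] by auto
  then have finA: "finite_dim A" using fin finite_dim_subset by blast
  let ?K = "{x :: bool \<Rightarrow> 'v. x True \<in> A \<and> x False \<in> B}"
  let ?f = "\<lambda>x :: bool \<Rightarrow> 'v. x True + x False" and ?g = "\<lambda>x :: bool \<Rightarrow> 'v. x True"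
  have K: "linear_family ?K"
    using A B by (auto simp: linear_family_def subspace_def)
  have f: "linear_form ?f"
    by (auto simp: linear_form_def scale_left_distrib algebra_simps)
  have g: "linear_form ?g" by (auto simp: linear_form_def)
  have fK: "?f ` ?K = span (A \<union> B)"
    unfolding span_Un[OF A B]
  proof (intro equalityI subsetI)
    fix v assume "v \<in> {a + b | a b. a \<in> A \<and> b \<in> B}"
    then obtain a b where ab: "v = a + b" "a \<in> A" "b \<in> B" by blast
    show "v \<in> ?f ` ?K"
      by (rule image_eqI[of _ _ "\<lambda>i. if i then a else b"]) (use ab in simp_all)
  qed blast
  have "?f ` {x \<in> ?K. ?g x \<in> A \<inter> B} \<subseteq> B" using subspace_add[OF B] by auto
  then have "dim (?f ` {x \<in> ?K. ?g x \<in> A \<inter> B}) \<le> dim B"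
    using sub fin finite_dim_subset by (intro dim_mono) blast+
  moreover have "dim (?f ` ?K) + dim (A \<inter> B) \<le> dim (?f ` {x \<in> ?K. ?g x \<in> A \<inter> B}) + dim A"
    using fin finA A B by (intro dim_restrict K f g subspace_Int) (auto simp: fK)
  ultimately show "dim (A \<inter> B) + dim (span (A \<union> B)) \<le> dim A + dim B" using fK by simp
  let ?L = "{x :: unit \<Rightarrow> 'v. x () \<in> A}" and ?h = "\<lambda>x :: unit \<Rightarrow> 'v. x ()"
  have L: "linear_family ?L" using A by (auto simp: linear_family_def subspace_def)
  have h: "linear_form ?h" by (auto simp: linear_form_def)
  have img: "?h ` {x. x () \<in> X} = X" for X
  proof (intro equalityI subsetI)
    fix a assume "a \<in> X"
    then show "a \<in> ?h ` {x. x () \<in> X}" by (intro image_eqI[of _ _ "\<lambda>_. a"]) auto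
  qed auto
  have hL: "?h ` ?L = A" by (rule img)
  have "{x \<in> ?L. ?h x \<in> B} = {x. x () \<in> A \<inter> B}" by auto
  then have "?h ` {x \<in> ?L. ?h x \<in> B} = A \<inter> B" by (simp only: img)
  moreover have "dim (?h ` ?L) + dim B \<le> dim (?h ` {x \<in> ?L. ?h x \<in> B}) + dim (span (A \<union> B))"
    using fin finA B sub by (intro dim_restrict L h subspace_span) (auto simp: hL)
  ultimately show "dim A + dim B \<le> dim (A \<inter> B) + dim (span (A \<union> B))" using hL by simp
qed

section \<open>The two dimension inequalities\<close>

definition join :: "('i \<Rightarrow> 'v set) \<Rightarrow> 'i set \<Rightarrow> 'v set" where
  "join V J = span (\<Union>j\<in>J. V j)"

lemma subspace_join: "subspace (join V J)"
  unfolding join_def by (rule subspace_span)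

lemma join_mono: "J \<subseteq> K \<Longrightarrow> join V J \<subseteq> join V K"
  unfolding join_def by (rule span_mono) auto

lemma join_mem: "j \<in> J \<Longrightarrow> x \<in> V j \<Longrightarrow> x \<in> join V J"
  unfolding join_def using span_superset by blast

lemma join_singleton: "subspace (V j) \<Longrightarrow> join V {j} = V j"
  unfolding join_def by (simp add: span_subspace)

lemma join_pair:
  assumes "subspace (V i)" "subspace (V j)"
  shows "join V {i, j} = {a + b | a b. a \<in> V i \<and> b \<in> V j}"
  unfolding join_def using span_Un[OF assms] by simp

lemma dim_join:
  assumes "finite_dim (join V L)" and "J \<union> K = L"
  shows "dim (join V J \<inter> join V K) + dim (join V L) = dim (join V J) + dim (join V K)"
proof -
  have "span (join V J \<union> join V K) = join V L"
  proof
    show "span (join V J \<union> join V K) \<subseteq> join V L"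
      using assms(2) by (intro span_minimal subspace_join Un_least join_mono) auto
    have "(\<Union>j\<in>L. V j) \<subseteq> join V J \<union> join V K"
      using assms(2) by (auto intro: join_mem)
    then show "join V L \<subseteq> span (join V J \<union> join V K)"
      unfolding join_def[of V L] by (rule span_mono)
  qed
  then show ?thesis
    using dim_Int_Un[OF subspace_join subspace_join, of V J V K] assms(1) by simp
qed

lemma linear_form_coordinate: "linear_form (\<lambda>x. x i)"
  unfolding linear_form_def by simp

text \<open>
  Here \<open>m\<close> is the observed coordinate. Starting from \<open>x 7 = x 2 + x 5\<close>, the conditions are imposed in
  the order \<open>x 7 = x 3 + x 6\<close>, then \<open>x 2 - x 6 \<in> V 1\<close>, then \<open>x 7 = x 1 + x 4\<close>, and finally
  \<open>x 2 - x 6 + x 1 = 0\<close>. The membership \<open>x 2 - x 6 \<in> V 1\<close> in between is what confines \<open>x 7\<close> to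
  \<open>V 1 + V 2 + V 3 + V 4\<close> before the third equation, and \<open>x 2 - x 6 + x 1\<close> to \<open>V 1\<close> before the last.
\<close>

lemma dim_fano_configurations:
  fixes V :: "nat \<Rightarrow> 'v set"
  assumes V: "\<And>i. i \<in> {1..7} \<Longrightarrow> subspace (V i)"
    and fin: "finite_dim (join V {1..7})"
    and m: "m = 5 \<or> m = 7"
  defines "r \<equiv> \<lambda>J. dim (join V J)"
    and "K \<equiv> {x. (\<forall>i\<in>{1..7}. x i \<in> V i) \<and> x 7 = x 2 + x 5}"
  shows "dim ((\<lambda>x. x m) ` K) + r {3,6} + r {1,4} + r {1,2,3,5,6,7} + r {1,2,3,4,7}
    \<le> dim ((\<lambda>x. x m) ` {x \<in> K. x 7 + x 7 = x 4 + x 5 + x 6})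
      + r {3,6,7} + r {1,4,7} + r {1,2,6} + r {1,3,5} + r {2,3,4}"
proof -
  let ?f = "\<lambda>x :: nat \<Rightarrow> 'v. x m"
  have finP: "finite_dim (join V J)" if "J \<subseteq> {1..7}" for J
    using finite_dim_subset[OF join_mono[OF that] fin] .
  have mod: "dim (join V I \<inter> join V J) + r L = r I + r J" if "I \<union> J = L" "L \<subseteq> {1..7}" for I J L
    unfolding r_def using that finP by (intro dim_join) auto
  have V_eq: "V i = join V {i}" if "i \<in> {1..7}" for i
    using join_singleton[of V i, OF V[OF that]] by simp
  have fin_f: "finite_dim (?f ` X)" if "X \<subseteq> K" for X
  proof (rule finite_dim_subset[OF _ fin])
    have "m \<in> {1..7}" using m by auto
    then have "x m \<in> V m" if "x \<in> X" for x
      using \<open>X \<subseteq> K\<close> that unfolding K_def by blast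
    then show "?f ` X \<subseteq> join V {1..7}"
      using join_mem[OF \<open>m \<in> {1..7}\<close>] by blast
  qed
  \<comment> \<open>The family \<open>Y\<close> may carry a condition in terms of the coordinates instead of \<open>g x \<in> W'\<close>; it is
    enough that every observed value survives, if need be after changing unobserved coordinates.\<close>
  have step: "dim (?f ` X) + dim W' \<le> dim (?f ` Y) + dim W"
    if "linear_family X" "X \<subseteq> K" "linear_form g" "subspace W" "subspace W'" "W' \<subseteq> W"
      "W \<subseteq> join V {1..7}" "\<And>x. x \<in> X \<Longrightarrow> g x \<in> W" "Y \<subseteq> K"
      "\<And>x. x \<in> X \<Longrightarrow> g x \<in> W' \<Longrightarrow> \<exists>y\<in>Y. y m = x m"
    for X Y :: "(nat \<Rightarrow> 'v) set" and g W W'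
  proof -
    have "dim (?f ` X) + dim W' \<le> dim (?f ` {x \<in> X. g x \<in> W'}) + dim W"
      using that fin_f finite_dim_subset[OF _ fin]
      by (intro dim_restrict linear_form_coordinate) auto
    moreover have "?f ` {x \<in> X. g x \<in> W'} \<subseteq> ?f ` Y" using that(10) by (auto simp: image_iff) metis
    then have "dim (?f ` {x \<in> X. g x \<in> W'}) \<le> dim (?f ` Y)"
      using fin_f that by (intro dim_mono) auto
    ultimately show ?thesis by linarith
  qed
  have K: "linear_family K"
    unfolding linear_family_def K_def using V
    by (auto simp: subspace_def scale_left_distrib algebra_simps)
  define K1 where "K1 = {x \<in> K. x 7 = x 3 + x 6}"
  define K2 where "K2 = {x \<in> K1. x 2 - x 6 \<in> V 1}"
  define K3 where "K3 = {x \<in> K2. x 7 = x 1 + x 4}"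
  have K1: "linear_family K1"
    using K unfolding linear_family_def K1_def
    by (auto simp: scale_left_distrib algebra_simps)
  have z: "linear_form (\<lambda>x. x 2 - x 6 :: 'v)"
    by (auto simp: linear_form_def scale_diff_left algebra_simps)
  have K2: "linear_family K2"
    unfolding K2_def by (rule linear_family_restrict[OF K1 z V]) simp
  have K3: "linear_family K3"
    using K2 unfolding linear_family_def K3_def
    by (auto simp: scale_left_distrib algebra_simps)
  have y: "linear_form (\<lambda>x. x 2 - x 6 + x 1 :: 'v)"
    by (auto simp: linear_form_def scale_diff_left scale_left_distrib algebra_simps)
  have in_V: "x i \<in> V i" if "x \<in> K" "i \<in> {1..7}" for x i
    using that unfolding K_def by blast
  have in_join: "x i \<in> join V J" if "x \<in> K" "i \<in> J" "i \<in> {1..7}" for x i J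
    using that in_V join_mem by metis
  note subspace_intros = subspace_join subspace_Int subspace_add[OF subspace_join]
    subspace_diff[OF subspace_join]
  have "dim (?f ` K) + dim (join V {7} \<inter> join V {3,6})
      \<le> dim (?f ` K1) + dim (join V {7} \<inter> join V {1,2,3,5,6})"
  proof (rule step[OF K order_refl linear_form_coordinate])
    fix x assume x: "x \<in> K"
    then have "x 7 = x 2 + x 5" by (simp add: K_def)
    then show "x 7 \<in> join V {7} \<inter> join V {1,2,3,5,6}"
      using in_join[OF x, of 2 "{1,2,3,5,6}"] in_join[OF x, of 5 "{1,2,3,5,6}"]
        in_join[OF x, of 7 "{7}"] by (auto intro: subspace_intros)
    assume "x 7 \<in> join V {7} \<inter> join V {3,6}"
    then obtain a b where ab: "x 7 = a + b" "a \<in> V 3" "b \<in> V 6"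
      using join_pair[of V 3 6, OF V V] by auto
    \<comment> \<open>So far \<open>x 3\<close> and \<open>x 6\<close> are subject to no equation and can be chosen anew.\<close>
    then have "x(3 := a, 6 := b) \<in> K1" using x by (auto simp: K1_def K_def)
    moreover have "(x(3 := a, 6 := b)) m = x m" using m by auto
    ultimately show "\<exists>y\<in>K1. y m = x m" by blast
  qed (auto simp: K1_def intro: subspace_intros join_mono[THEN subsetD, rotated])
  moreover have "dim (?f ` K1) + dim (V 1) \<le> dim (?f ` K2) + dim (join V {1,2,6} \<inter> join V {1,3,5})"
  proof (rule step[OF K1 _ z])
    show "V 1 \<subseteq> join V {1,2,6} \<inter> join V {1,3,5}" using join_mem[of 1] by blast
    show "join V {1,2,6} \<inter> join V {1,3,5} \<subseteq> join V {1..7}"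
      by (rule le_infI1, rule join_mono) simp
  next
    fix x assume x1: "x \<in> K1"
    then have x: "x \<in> K" and eq: "x 7 = x 2 + x 5" "x 7 = x 3 + x 6"
      by (auto simp: K1_def K_def)
    have "x 2 - x 6 = x 3 - x 5" using eq by (simp add: algebra_simps)
    moreover have "x 2 - x 6 \<in> join V {1,2,6}" "x 3 - x 5 \<in> join V {1,3,5}"
      by (auto intro!: subspace_intros in_join[OF x])
    ultimately show "x 2 - x 6 \<in> join V {1,2,6} \<inter> join V {1,3,5}" by simp
    assume "x 2 - x 6 \<in> V 1"
    then show "\<exists>y\<in>K2. y m = x m" using x1 by (auto simp: K2_def)
  qed (auto simp: K1_def K2_def intro: subspace_intros V)
  moreover have "dim (?f ` K2) + dim (join V {7} \<inter> join V {1,4})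
      \<le> dim (?f ` K3) + dim (join V {7} \<inter> join V {1,2,3,4})"
  proof (rule step[OF K2 _ linear_form_coordinate])
    fix x assume x2: "x \<in> K2"
    then have x: "x \<in> K" and eq: "x 7 = x 2 + x 5" "x 7 = x 3 + x 6" and z1: "x 2 - x 6 \<in> V 1"
      by (auto simp: K1_def K2_def K_def)
    have "x 7 = x 3 + x 2 - (x 2 - x 6)" using eq by simp
    also have "\<dots> \<in> join V {1,2,3,4}"
      using z1 by (intro subspace_intros in_join[OF x] join_mem[of 1]) auto
    finally show "x 7 \<in> join V {7} \<inter> join V {1,2,3,4}" using in_join[OF x] by simp
    assume "x 7 \<in> join V {7} \<inter> join V {1,4}"
    then obtain a b where ab: "x 7 = a + b" "a \<in> V 1" "b \<in> V 4"
      using join_pair[of V 1 4, OF V V] by auto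
    \<comment> \<open>Likewise \<open>x 1\<close> and \<open>x 4\<close>: the condition defining \<open>K2\<close> mentions \<open>V 1\<close> but not \<open>x 1\<close>.\<close>
    then have "x(1 := a, 4 := b) \<in> K3" using x2 by (auto simp: K1_def K2_def K3_def K_def)
    moreover have "(x(1 := a, 4 := b)) m = x m" using m by auto
    ultimately show "\<exists>y\<in>K3. y m = x m" by blast
  qed (auto simp: K1_def K2_def K3_def intro: subspace_intros join_mono[THEN subsetD, rotated])
  moreover have "dim (?f ` K3) + dim {0 :: 'v}
      \<le> dim (?f ` {x \<in> K. x 7 + x 7 = x 4 + x 5 + x 6}) + dim (join V {1} \<inter> join V {2,3,4})"
  proof (rule step[OF K3 _ y])
    fix x assume x3: "x \<in> K3"
    then have x: "x \<in> K" and eq: "x 7 = x 2 + x 5" "x 7 = x 3 + x 6" "x 7 = x 1 + x 4"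
      and z1: "x 2 - x 6 \<in> V 1"
      by (auto simp: K1_def K2_def K3_def K_def)
    \<comment> \<open>Adding \<open>- x 7 + x 7\<close>, once as \<open>x 3 + x 6\<close> and once as \<open>x 1 + x 4\<close>, trades \<open>x 6\<close> and \<open>x 1\<close> for \<open>x 3\<close>
      and \<open>x 4\<close>.\<close>
    have "x 2 - x 6 + x 1 = x 2 + x 3 - (x 3 + x 6) + (x 1 + x 4) - x 4"
      by (simp add: algebra_simps)
    also have "\<dots> = x 2 + x 3 - x 4" using eq(2,3) by (simp add: algebra_simps)
    also have "\<dots> \<in> join V {2,3,4}" by (auto intro!: subspace_intros in_join[OF x])
    finally have "x 2 - x 6 + x 1 \<in> join V {2,3,4}" .
    moreover have "x 2 - x 6 + x 1 \<in> V 1"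
      using z1 in_V[OF x, of 1] by (intro subspace_add V) auto
    ultimately show "x 2 - x 6 + x 1 \<in> join V {1} \<inter> join V {2,3,4}" using V_eq by simp
    assume "x 2 - x 6 + x 1 \<in> {0}"
    then have "x 6 = x 1 + x 2" by (simp add: algebra_simps)
    have "x 7 + x 7 = x 4 + x 5 + x 6"
    proof -
      have "x 7 + x 7 = (x 1 + x 4) + (x 2 + x 5)" using eq by simp
      also have "\<dots> = x 4 + x 5 + (x 1 + x 2)" by (simp add: algebra_simps)
      finally show ?thesis using \<open>x 6 = x 1 + x 2\<close> by simp
    qed
    then show "\<exists>y\<in>{x \<in> K. x 7 + x 7 = x 4 + x 5 + x 6}. y m = x m" using x by blast
  qed (auto simp: K1_def K2_def K3_def subspace_0[OF subspace_join] intro!: subspace_intros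
        intro: join_mono[THEN subsetD, rotated], auto simp: subspace_def)
  \<comment> \<open>The dimensions of the intersections, by the modular law; the auxiliary terms cancel.\<close>
  moreover have "dim (V 1) = r {1}" using V_eq[of 1] by (simp add: r_def)
  moreover note dim_zero
  moreover have "dim (join V {7} \<inter> join V {3,6}) + r {3,6,7} = r {7} + r {3,6}"
    by (rule mod) auto
  moreover have "dim (join V {7} \<inter> join V {1,2,3,5,6}) + r {1,2,3,5,6,7} = r {7} + r {1,2,3,5,6}"
    by (rule mod) auto
  moreover have "dim (join V {1,2,6} \<inter> join V {1,3,5}) + r {1,2,3,5,6} = r {1,2,6} + r {1,3,5}"
    by (rule mod) auto
  moreover have "dim (join V {7} \<inter> join V {1,4}) + r {1,4,7} = r {7} + r {1,4}"
    by (rule mod) auto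
  moreover have "dim (join V {7} \<inter> join V {1,2,3,4}) + r {1,2,3,4,7} = r {7} + r {1,2,3,4}"
    by (rule mod) auto
  moreover have "dim (join V {1} \<inter> join V {2,3,4}) + r {1,2,3,4} = r {1} + r {2,3,4}"
    by (rule mod) auto
  ultimately show ?thesis by linarith
qed

lemma double_eq_0:
  fixes x :: 'v
  assumes "CHAR('f) = 2"
  shows "x + x = 0"
proof -
  have "(1 + 1 :: 'f) = 0" using of_nat_CHAR[where 'a = 'f] assms by simp
  then show ?thesis using scale_right_distrib[of x 1 1] by (simp add: scale_one)
qed

lemma half_mem:
  assumes "CHAR('f) \<noteq> 2" "subspace W" "x + x \<in> W"
  shows "x \<in> W"
proof -
  have "CHAR('f) \<noteq> 1" using of_nat_CHAR[where 'a = 'f] by auto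
  have "\<not> CHAR('f) dvd 2"
  proof
    assume dvd: "CHAR('f) dvd 2"
    then have "CHAR('f) \<le> 2" by (rule dvd_imp_le) simp
    then have "CHAR('f) = 0" using \<open>CHAR('f) \<noteq> 1\<close> assms(1) by linarith
    then show False using dvd by simp
  qed
  then have ne: "(1 + 1 :: 'f) \<noteq> 0" using of_nat_eq_0_iff_char_dvd[where 'a = 'f, of 2] by simp
  have "x + x = x \<cdot> (1 + 1)" using scale_right_distrib[of x 1 1] by (simp add: scale_one)
  then have "(x + x) \<cdot> inverse (1 + 1) = x" using ne by (simp flip: scale_scale add: scale_one)
  then show ?thesis using subspace_scale[OF assms(2,3), of "inverse (1 + 1)"] by simp
qed

text \<open>
  The observed coordinate is \<open>x 5\<close>. Initially its values are those in \<open>V 5 \<inter> (V 2 + V 7)\<close>. In the end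
  \<open>0 = 2 x 7 = x 4 + x 5 + x 6\<close> confines it to \<open>V 5 \<inter> (V 4 + V 6)\<close>.
\<close>

lemma dim_inequality_char_2:
  fixes V :: "nat \<Rightarrow> 'v set"
  assumes char: "CHAR('f) = 2"
    and V: "\<And>i. i \<in> {1..7} \<Longrightarrow> subspace (V i)"
    and fin: "finite_dim (join V {1..7})"
  defines "r \<equiv> \<lambda>J. dim (join V J)"
  shows "r {3,6} + r {1,4} + r {2,7} + r {4,5,6} + r {1,2,3,4,7} + r {1,2,3,5,6,7}
    \<le> r {4,6} + r {2,3,4} + r {1,3,5} + r {1,2,6} + r {3,6,7} + r {1,4,7} + r {2,5,7}"
proof -
  define K where "K = {x. (\<forall>i\<in>{1..7}. x i \<in> V i) \<and> x 7 = x 2 + x 5}"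
  have finP: "finite_dim (join V J)" if "J \<subseteq> {1..7}" for J
    using finite_dim_subset[OF join_mono[OF that] fin] .
  have "join V {5} \<inter> join V {2,7} \<subseteq> (\<lambda>x. x 5) ` K"
  proof
    fix v assume "v \<in> join V {5} \<inter> join V {2,7}"
    then obtain a b where v: "v \<in> V 5" "v = a + b" "a \<in> V 2" "b \<in> V 7"
      using join_pair[of V 2 7, OF V V] join_singleton[of V 5] V by auto
    then have "(\<lambda>_. 0)(2 := - a, 5 := v, 7 := b) \<in> K"
      using V subspace_0 subspace_neg unfolding K_def by auto
    then show "v \<in> (\<lambda>x. x 5) ` K" by (rule rev_image_eqI) simp
  qed
  moreover have "x 5 \<in> V 5" if "x \<in> K" for x
    using that unfolding K_def by (elim CollectE conjE bspec) simp
  then have "(\<lambda>x. x 5) ` K \<subseteq> join V {5}"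
    by (intro image_subsetI join_mem[of 5]) simp_all
  then have "finite_dim ((\<lambda>x. x 5) ` K)" using finP[of "{5}"] finite_dim_subset by auto
  ultimately have "dim (join V {5} \<inter> join V {2,7}) \<le> dim ((\<lambda>x. x 5) ` K)"
    by (rule dim_mono)
  moreover have "(\<lambda>x. x 5) ` {x \<in> K. x 7 + x 7 = x 4 + x 5 + x 6} \<subseteq> join V {5} \<inter> join V {4,6}"
  proof clarify
    fix x assume x: "x \<in> K" and "x 7 + x 7 = x 4 + x 5 + x 6"
    then have "x 5 = - x 4 - x 6"
      using double_eq_0[OF char, of "x 7"] by (simp add: eq_diff_eq eq_neg_iff_add_eq_0 algebra_simps)
    moreover have "x 4 \<in> join V {4,6}" "x 6 \<in> join V {4,6}" "x 5 \<in> join V {5}"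
      using x by (auto simp: K_def intro: join_mem)
    ultimately show "x 5 \<in> join V {5} \<inter> join V {4,6}"
      using subspace_diff[OF subspace_join] subspace_neg[OF subspace_join] by (metis IntI)
  qed
  then have "dim ((\<lambda>x. x 5) ` {x \<in> K. x 7 + x 7 = x 4 + x 5 + x 6}) \<le> dim (join V {5} \<inter> join V {4,6})"
    using finite_dim_subset[OF Int_lower1 finP[of "{5}"]] by (intro dim_mono) auto
  moreover have "dim (join V {5} \<inter> join V {2,7}) + r {2,5,7} = r {5} + r {2,7}"
    "dim (join V {5} \<inter> join V {4,6}) + r {4,5,6} = r {5} + r {4,6}"
    unfolding r_def by (auto intro!: dim_join finP)
  moreover note dim_fano_configurations[OF V fin, of 5, folded K_def]
  ultimately show ?thesis unfolding r_def by simp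
qed

text \<open>
  The observed coordinate is \<open>x 7\<close>. Initially its values are those in \<open>V 7 \<inter> (V 2 + V 5)\<close>. In the end
  \<open>2 x 7 = x 4 + x 5 + x 6\<close> can be divided by 2.
\<close>

lemma dim_inequality_char_not_2:
  fixes V :: "nat \<Rightarrow> 'v set"
  assumes char: "CHAR('f) \<noteq> 2"
    and V: "\<And>i. i \<in> {1..7} \<Longrightarrow> subspace (V i)"
    and fin: "finite_dim (join V {1..7})"
  defines "r \<equiv> \<lambda>J. dim (join V J)"
  shows "r {3,6} + r {1,4} + r {2,5} + r {4,5,6,7} + r {1,2,3,4,7} + r {1,2,3,5,6,7}
    \<le> r {1,2,6} + r {1,3,5} + r {2,3,4} + r {3,6,7} + r {1,4,7} + r {4,5,6} + r {2,5,7}"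
proof -
  define K where "K = {x. (\<forall>i\<in>{1..7}. x i \<in> V i) \<and> x 7 = x 2 + x 5}"
  have finP: "finite_dim (join V J)" if "J \<subseteq> {1..7}" for J
    using finite_dim_subset[OF join_mono[OF that] fin] .
  have "join V {7} \<inter> join V {2,5} \<subseteq> (\<lambda>x. x 7) ` K"
  proof
    fix v assume "v \<in> join V {7} \<inter> join V {2,5}"
    then obtain a b where v: "v \<in> V 7" "v = a + b" "a \<in> V 2" "b \<in> V 5"
      using join_pair[of V 2 5, OF V V] join_singleton[of V 7] V by auto
    then have "(\<lambda>_. 0)(2 := a, 5 := b, 7 := v) \<in> K"
      using V subspace_0 unfolding K_def by auto
    then show "v \<in> (\<lambda>x. x 7) ` K" by (rule rev_image_eqI) simp
  qed
  moreover have "x 7 \<in> V 7" if "x \<in> K" for x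
    using that unfolding K_def by (elim CollectE conjE bspec) simp
  then have "(\<lambda>x. x 7) ` K \<subseteq> join V {7}"
    by (intro image_subsetI join_mem[of 7]) simp_all
  then have "finite_dim ((\<lambda>x. x 7) ` K)" using finP[of "{7}"] finite_dim_subset by auto
  ultimately have "dim (join V {7} \<inter> join V {2,5}) \<le> dim ((\<lambda>x. x 7) ` K)"
    by (rule dim_mono)
  moreover have "(\<lambda>x. x 7) ` {x \<in> K. x 7 + x 7 = x 4 + x 5 + x 6} \<subseteq> join V {7} \<inter> join V {4,5,6}"
  proof clarify
    fix x assume x: "x \<in> K" and eq: "x 7 + x 7 = x 4 + x 5 + x 6"
    have "x 4 \<in> join V {4,5,6}" "x 5 \<in> join V {4,5,6}" "x 6 \<in> join V {4,5,6}"
      using x by (auto simp: K_def intro: join_mem)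
    then have "x 7 + x 7 \<in> join V {4,5,6}"
      unfolding eq by (intro subspace_add subspace_join)
    then have "x 7 \<in> join V {4,5,6}" by (rule half_mem[OF char subspace_join])
    moreover have "x 7 \<in> V 7"
      using x unfolding K_def by (elim CollectE conjE bspec) simp
    then have "x 7 \<in> join V {7}" by (intro join_mem) simp_all
    ultimately show "x 7 \<in> join V {7} \<inter> join V {4,5,6}" by simp
  qed
  then have "dim ((\<lambda>x. x 7) ` {x \<in> K. x 7 + x 7 = x 4 + x 5 + x 6}) \<le> dim (join V {7} \<inter> join V {4,5,6})"
    using finite_dim_subset[OF Int_lower1 finP[of "{7}"]] by (intro dim_mono) auto
  moreover have "dim (join V {7} \<inter> join V {2,5}) + r {2,5,7} = r {7} + r {2,5}"
    "dim (join V {7} \<inter> join V {4,5,6}) + r {4,5,6,7} = r {7} + r {4,5,6}"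
    unfolding r_def by (auto intro!: dim_join finP)
  moreover note dim_fano_configurations[OF V fin, of 7, folded K_def]
  ultimately show ?thesis unfolding r_def by simp
qed

end

section \<open>Transfer to representable polymatroid functions\<close>

lemma representable_subspaces:
  assumes "representable_over TYPE('f::division_ring) TYPE('v::ab_group_add) S (\<lambda>X. real k * \<phi> X)"
    and A: "\<forall>i\<in>{1..7}. A i \<subseteq> S"
  obtains scale :: "'v::ab_group_add \<Rightarrow> 'f::division_ring \<Rightarrow> 'v" and V :: "nat \<Rightarrow> 'v set"
  where "right_vector_space scale"
    and "\<And>i. right_vector_space.subspace scale (V i)"
    and "right_vector_space.finite_dim scale (right_vector_space.join scale V {1..7})"
    and "\<And>J. J \<subseteq> {1..7} \<Longrightarrow>
      real k * \<phi> (\<Union>j\<in>J. A j) = real (right_vector_space.dim scale (right_vector_space.join scale V J))"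
proof -
  obtain scale :: "'v \<Rightarrow> 'f \<Rightarrow> 'v" and U where "right_vector_space scale"
    and U: "\<forall>X\<subseteq>S. \<exists>n. right_vector_space.has_dimension scale
      (right_vector_space.span scale (\<Union>s\<in>X. U s)) n \<and> real k * \<phi> X = real n"
    using assms(1) unfolding representable_over_def by blast
  interpret right_vector_space scale by fact
  define V where "V i = span (\<Union>s\<in>A i. U s)" for i
  have join_V: "join V J = span (\<Union>s\<in>(\<Union>j\<in>J. A j). U s)" for J
  proof
    show "join V J \<subseteq> span (\<Union>s\<in>(\<Union>j\<in>J. A j). U s)"
      unfolding join_def V_def
      by (intro span_subset_span UN_least span_mono) auto
    have "U s \<subseteq> join V J" if "j \<in> J" "s \<in> A j" for s j
      using that span_superset[of "\<Union>s\<in>A j. U s"] unfolding V_def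
      by (intro subsetI join_mem[of j]) auto
    then show "span (\<Union>s\<in>(\<Union>j\<in>J. A j). U s) \<subseteq> join V J"
      by (intro span_minimal subspace_join) blast
  qed
  have dimension: "finite_dim (join V J) \<and> real k * \<phi> (\<Union>j\<in>J. A j) = real (dim (join V J))"
    if "J \<subseteq> {1..7}" for J
  proof -
    have "(\<Union>j\<in>J. A j) \<subseteq> S" using that A by blast
    then obtain n where "has_dimension (join V J) n" "real k * \<phi> (\<Union>j\<in>J. A j) = real n"
      using U unfolding join_V by blast
    then show ?thesis using has_dimension_dim by auto
  qed
  show thesis
    by (rule that[of scale V]) (use dimension in \<open>auto simp: V_def intro: subspace_span right_vector_space_axioms\<close>)
qed

lemma polymatroid_subadditive:
  assumes "polymatroid S \<phi>" "X \<subseteq> S" "Y \<subseteq> S"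
  shows "\<phi> (X \<union> Y) \<le> \<phi> X + \<phi> Y"
proof -
  have mono: "\<forall>X Y. X \<subseteq> Y \<and> Y \<subseteq> S \<longrightarrow> \<phi> X \<le> \<phi> Y" and "\<phi> {} = 0"
    and submodular: "\<forall>X Y. X \<subseteq> S \<and> Y \<subseteq> S \<longrightarrow> \<phi> (X \<union> Y) + \<phi> (X \<inter> Y) \<le> \<phi> X + \<phi> Y"
    using assms(1) unfolding polymatroid_def by simp_all
  have "\<phi> {} \<le> \<phi> (X \<inter> Y)" using mono[rule_format, of "{}" "X \<inter> Y"] assms(2) by blast
  moreover have "\<phi> (X \<union> Y) + \<phi> (X \<inter> Y) \<le> \<phi> X + \<phi> Y"
    using submodular assms(2,3) by simp
  ultimately show ?thesis using \<open>\<phi> {} = 0\<close> by linarith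
qed

lemma char_2_inequality_of_representable:
  fixes \<phi> :: "'s set \<Rightarrow> real"
  assumes "polymatroid S \<phi>" and char: "CHAR('f::division_ring) = 2" and k: "0 < k"
    and rep: "representable_over TYPE('f) TYPE('v::ab_group_add) S (\<lambda>X. real k * \<phi> X)"
    and A: "\<forall>i\<in>{1..7}. A i \<subseteq> S"
  shows "char_2_inequality \<phi> A"
proof -
  obtain scale :: "'v \<Rightarrow> 'f \<Rightarrow> 'v" and V where "right_vector_space scale"
    and V: "\<And>i. right_vector_space.subspace scale (V i)"
    and fin: "right_vector_space.finite_dim scale (right_vector_space.join scale V {1..7})"
    and r: "\<And>J. J \<subseteq> {1..7} \<Longrightarrow>
      real k * \<phi> (\<Union>j\<in>J. A j) = real (right_vector_space.dim scale (right_vector_space.join scale V J))"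
    using representable_subspaces[OF rep A] by metis
  interpret right_vector_space scale by fact
  define a where "a J = \<phi> (\<Union>j\<in>J. A j)" for J
  have r: "real (dim (join V J)) = real k * a J" if "J \<subseteq> {1..7}" for J
    using r[OF that] unfolding a_def by simp
  have "a {4,6} \<le> a {4} + a {6}"
    using polymatroid_subadditive[OF assms(1), of "A 4" "A 6"] A unfolding a_def by simp
  moreover have "real k * (a {3,6} + a {1,4} + a {2,7} + a {4,5,6} + a {1,2,3,4,7} + a {1,2,3,5,6,7})
    \<le> real k * (a {4,6} + a {2,3,4} + a {1,3,5} + a {1,2,6} + a {3,6,7} + a {1,4,7} + a {2,5,7})"
    using dim_inequality_char_2[OF char V fin, THEN of_nat_mono[where 'a = real]]
    by (simp add: r algebra_simps)
  ultimately show ?thesis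
    using k unfolding char_2_inequality_def Let_def a_def[symmetric]
    by (simp only: mult_le_cancel_left_pos of_nat_0_less_iff)
qed

lemma char_not_2_inequality_of_representable:
  fixes \<phi> :: "'s set \<Rightarrow> real"
  assumes "polymatroid S \<phi>" and char: "CHAR('f::division_ring) \<noteq> 2" and k: "0 < k"
    and rep: "representable_over TYPE('f) TYPE('v::ab_group_add) S (\<lambda>X. real k * \<phi> X)"
    and A: "\<forall>i\<in>{1..7}. A i \<subseteq> S"
  shows "char_not_2_inequality \<phi> A"
proof -
  obtain scale :: "'v \<Rightarrow> 'f \<Rightarrow> 'v" and V where "right_vector_space scale"
    and V: "\<And>i. right_vector_space.subspace scale (V i)"
    and fin: "right_vector_space.finite_dim scale (right_vector_space.join scale V {1..7})"
    and r: "\<And>J. J \<subseteq> {1..7} \<Longrightarrow>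
      real k * \<phi> (\<Union>j\<in>J. A j) = real (right_vector_space.dim scale (right_vector_space.join scale V J))"
    using representable_subspaces[OF rep A] by metis
  interpret right_vector_space scale by fact
  define a where "a J = \<phi> (\<Union>j\<in>J. A j)" for J
  have r: "real (dim (join V J)) = real k * a J" if "J \<subseteq> {1..7}" for J
    using r[OF that] unfolding a_def by simp
  have "a {4,6} \<le> a {4} + a {6}"
    using polymatroid_subadditive[OF assms(1), of "A 4" "A 6"] A unfolding a_def by simp
  moreover have "real k * (a {3,6} + a {1,4} + a {2,5} + a {4,5,6,7} + a {1,2,3,4,7} + a {1,2,3,5,6,7})
    \<le> real k * (a {1,2,6} + a {1,3,5} + a {2,3,4} + a {3,6,7} + a {1,4,7} + a {4,5,6} + a {2,5,7})"
    using dim_inequality_char_not_2[OF char V fin, THEN of_nat_mono[where 'a = real]]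
    by (simp add: r algebra_simps)
  ultimately show ?thesis
    using k unfolding char_not_2_inequality_def Let_def a_def[symmetric]
    by (simp only: mult_le_cancel_left_pos of_nat_0_less_iff)
qed

section \<open>Ranks in seven-point planes\<close>

context
  fixes \<L> :: "nat set set" and S :: "'s set" and indep :: "'s set \<Rightarrow> bool" and s :: "nat \<Rightarrow> 's"
  assumes plane: "seven_point_plane \<L> S indep s"
begin

lemma plane_finite: "finite S"
  using plane unfolding seven_point_plane_def simple_matroid_def matroid_def by auto

lemma plane_finite_independent: "X \<subseteq> S \<Longrightarrow> finite {I. I \<subseteq> X \<and> indep I}"
  by (rule finite_subset[of _ "Pow S"]) (use plane_finite in auto)

lemma plane_rank_ge: "I \<subseteq> X \<Longrightarrow> X \<subseteq> S \<Longrightarrow> indep I \<Longrightarrow> card I \<le> matroid_rank indep X"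
  unfolding matroid_rank_def using plane_finite_independent by (intro Max_ge) auto

lemma plane_rank_le:
  assumes "X \<subseteq> S" "\<And>I. I \<subseteq> X \<Longrightarrow> indep I \<Longrightarrow> card I \<le> n"
  shows "matroid_rank indep X \<le> n"
proof -
  have "indep {}" using plane unfolding seven_point_plane_def simple_matroid_def matroid_def by auto
  then have "{I. I \<subseteq> X \<and> indep I} \<noteq> {}" by blast
  then show ?thesis
    unfolding matroid_rank_def using assms plane_finite_independent by (subst Max_le_iff) auto
qed

lemma plane_image_subset: "J \<subseteq> {1..7} \<Longrightarrow> s ` J \<subseteq> S"
  using plane unfolding seven_point_plane_def bij_betw_def by blast

lemma plane_rank_point:
  assumes "i \<in> {1..7}" shows "matroid_rank indep (s ` {i}) \<le> 1"
  using assms plane_image_subset[of "{i}"]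
  by (intro plane_rank_le) (auto dest!: card_mono[rotated])

lemma plane_rank_pair:
  assumes "i \<in> {1..7}" "j \<in> {1..7}" "i \<noteq> j" "{s i, s j} \<subseteq> X" "X \<subseteq> S"
  shows "2 \<le> matroid_rank indep X"
proof -
  have ne: "s i \<noteq> s j" and "s i \<in> S" "s j \<in> S"
    using plane assms unfolding seven_point_plane_def bij_betw_def by (auto dest: inj_onD)
  then have "indep {s i, s j}"
    using plane unfolding seven_point_plane_def simple_matroid_def by blast
  then have "card {s i, s j} \<le> matroid_rank indep X"
    using assms by (intro plane_rank_ge) auto
  then show ?thesis using ne by simp
qed

lemma plane_rank_line: "L \<in> \<L> \<Longrightarrow> matroid_rank indep (s ` L) = 2"
  using plane unfolding seven_point_plane_def line_def by blast

text \<open>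
  If the rank were at most 2, then a superset of rank at most 2 of maximal size would be a flat, because
  adding any further point raises its rank. It would then be a line with at least three points, hence
  a listed one.
\<close>

lemma plane_rank_noncollinear:
  assumes J: "J \<subseteq> {1..7}" "3 \<le> card J" and noncollinear: "\<And>L. L \<in> \<L> \<Longrightarrow> \<not> J \<subseteq> L"
    and lines: "\<And>L. L \<in> \<L> \<Longrightarrow> L \<subseteq> {1..7}"
  shows "3 \<le> matroid_rank indep (s ` J)"
proof (rule ccontr)
  assume neg: "\<not> ?thesis"
  have inj: "inj_on s {1..7}" using plane unfolding seven_point_plane_def bij_betw_def by blast
  define P where "P F \<longleftrightarrow> s ` J \<subseteq> F \<and> F \<subseteq> S \<and> matroid_rank indep F \<le> 2" for F
  have "P (s ` J)" using neg plane_image_subset[OF J(1)] by (simp add: P_def)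
  moreover have "\<forall>F. P F \<longrightarrow> card F < Suc (card S)"
    using plane_finite by (simp add: P_def card_mono less_Suc_eq_le)
  ultimately have "\<exists>F. P F \<and> (\<forall>G. P G \<longrightarrow> card G \<le> card F)" by (rule ex_has_greatest_nat)
  then obtain F where "P F" and max: "\<And>G. P G \<Longrightarrow> card G \<le> card F" by blast
  then have F: "s ` J \<subseteq> F" "F \<subseteq> S" "matroid_rank indep F \<le> 2" by (simp_all add: P_def)
  have finF: "finite F" using F plane_finite finite_subset by blast
  have cardF: "3 \<le> card F"
    using J F card_mono[OF finF, of "s ` J"] card_image[OF inj_on_subset[OF inj J(1)]] by simp
  obtain i j where ij: "i \<in> J" "j \<in> J" "i \<noteq> j"
    using J(2) card_le_Suc0_iff_eq[of J] finite_subset[OF J(1)] by fastforce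
  have "2 \<le> matroid_rank indep F"
    using ij J(1) F by (intro plane_rank_pair[of i j]) auto
  then have rF: "matroid_rank indep F = 2" using F by simp
  have "matroid_rank indep F < matroid_rank indep (insert x F)" if x: "x \<in> S - F" for x
  proof (rule ccontr)
    assume "\<not> ?thesis"
    then have "P (insert x F)" unfolding P_def using F x rF by auto
    then have "card (insert x F) \<le> card F" by (rule max)
    then show False using x finF by simp
  qed
  then have "line S indep F" unfolding line_def flat_def using F rF by auto
  then have "F \<in> (\<lambda>L. s ` L) ` \<L>"
    using plane cardF unfolding seven_point_plane_def by blast
  then obtain L where L: "L \<in> \<L>" "F = s ` L" by blast
  then have "J \<subseteq> L"
    using F(1) J(1) lines[OF L(1)] inj by (auto dest: inj_onD)
  then show False using noncollinear L(1) by blast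
qed

end

lemma UN_point_sets: "(\<Union>j\<in>J. {s j}) = s ` J"
  by auto

section \<open>The violations and the theorem\<close>

text \<open>
  The left-hand side is at most \<open>2 + 6 * 2 = 14\<close> and the right-hand side at least \<open>3 * 2 + 3 * 3 = 15\<close>.
  The decisive set is \<open>{4, 5, 6}\<close>, which has rank 3 here.
\<close>

lemma non_fano_violates:
  assumes plane: "non_fano_matroid S indep t"
    and \<phi>: "\<forall>X\<subseteq>S. \<phi> X = real (matroid_rank indep X)"
  shows "\<not> char_2_inequality \<phi> (\<lambda>i. {t i})"
proof -
  note P = plane[unfolded non_fano_matroid_def]
  define b where "b J = \<phi> (\<Union>j\<in>J. {t j})" for J
  have b: "b J = real (matroid_rank indep (t ` J))" if "J \<subseteq> {1..7}" for J
    unfolding b_def UN_point_sets using \<phi> plane_image_subset[OF P that] by blast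
  have pt: "b {i} \<le> 1" if "i \<in> {1..7}" for i
    using plane_rank_point[OF P that] b[of "{i}"] that by auto
  have pair: "2 \<le> b {i,j}" if "i \<in> {1..7}" "j \<in> {1..7}" "i \<noteq> j" for i j
    using plane_rank_pair[OF P that, of "t ` {i,j}"] plane_image_subset[OF P, of "{i,j}"]
      b[of "{i,j}"] that by simp
  have lines: "\<forall>L\<in>non_fano_lines. L \<subseteq> {1..7}" by code_simp
  have line: "b L = 2" if "L \<in> non_fano_lines" for L
    using plane_rank_line[OF P that] b[of L] that lines by auto
  have big: "3 \<le> b J" if "J \<subseteq> {1..7}" "3 \<le> card J" "\<forall>L\<in>non_fano_lines. \<not> J \<subseteq> L" for J
    using plane_rank_noncollinear[OF P that(1,2)] that b[OF that(1)] lines by auto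
  have "b {2,3,4} = 2" "b {1,3,5} = 2" "b {1,2,6} = 2" "b {3,6,7} = 2" "b {1,4,7} = 2" "b {2,5,7} = 2"
    by (rule line, simp add: non_fano_lines_def)+
  moreover have "b {4} \<le> 1" "b {6} \<le> 1" by (rule pt, simp)+
  moreover have "2 \<le> b {3,6}" "2 \<le> b {1,4}" "2 \<le> b {2,7}" by (rule pair; simp)+
  moreover have "3 \<le> b {4,5,6}" "3 \<le> b {1,2,3,4,7}" "3 \<le> b {1,2,3,5,6,7}"
    by (rule big; simp add: non_fano_lines_def)+
  ultimately show ?thesis
    unfolding char_2_inequality_def Let_def b_def[symmetric] by linarith
qed

text \<open>
  The left-hand side is at most \<open>2 + 7 * 2 = 16\<close> and the right-hand side at least \<open>4 * 2 + 3 * 3 = 17\<close>.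
  The decisive set is \<open>{4, 5, 6}\<close>, which has rank 2 here.
\<close>

lemma fano_violates:
  assumes plane: "fano_matroid S indep s"
    and \<phi>: "\<forall>X\<subseteq>S. \<phi> X = real (matroid_rank indep X)"
  shows "\<not> char_not_2_inequality \<phi> (\<lambda>i. {s i})"
proof -
  note P = plane[unfolded fano_matroid_def]
  define a where "a J = \<phi> (\<Union>j\<in>J. {s j})" for J
  have a: "a J = real (matroid_rank indep (s ` J))" if "J \<subseteq> {1..7}" for J
    unfolding a_def UN_point_sets using \<phi> plane_image_subset[OF P that] by blast
  have pt: "a {i} \<le> 1" if "i \<in> {1..7}" for i
    using plane_rank_point[OF P that] a[of "{i}"] that by auto
  have pair: "2 \<le> a {i,j}" if "i \<in> {1..7}" "j \<in> {1..7}" "i \<noteq> j" for i j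
    using plane_rank_pair[OF P that, of "s ` {i,j}"] plane_image_subset[OF P, of "{i,j}"]
      a[of "{i,j}"] that by simp
  have lines: "\<forall>L\<in>fano_lines. L \<subseteq> {1..7}" by code_simp
  have line: "a L = 2" if "L \<in> fano_lines" for L
    using plane_rank_line[OF P that] a[of L] that lines by auto
  have big: "3 \<le> a J" if "J \<subseteq> {1..7}" "3 \<le> card J" "\<forall>L\<in>fano_lines. \<not> J \<subseteq> L" for J
    using plane_rank_noncollinear[OF P that(1,2)] that a[OF that(1)] lines by auto
  have "a {2,3,4} = 2" "a {1,3,5} = 2" "a {1,2,6} = 2" "a {3,6,7} = 2" "a {1,4,7} = 2"
      "a {2,5,7} = 2" "a {4,5,6} = 2"
    by (rule line, simp add: fano_lines_def)+
  moreover have "a {4} \<le> 1" "a {6} \<le> 1" by (rule pt, simp)+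
  moreover have "2 \<le> a {3,6}" "2 \<le> a {1,4}" "2 \<le> a {4,6}" "2 \<le> a {2,5}" by (rule pair; simp)+
  moreover have "3 \<le> a {4,5,6,7}" "3 \<le> a {1,2,3,4,7}" "3 \<le> a {1,2,3,5,6,7}"
    by (rule big; simp add: fano_lines_def)+
  ultimately show ?thesis
    unfolding char_not_2_inequality_def Let_def a_def[symmetric] by linarith
qed

theorem corollary7p6:
  fixes \<phi>1 :: "'a set \<Rightarrow> real" and \<phi>2 :: "'b set \<Rightarrow> real"
    and S1 :: "'a set" and S2 :: "'b set"
  assumes "polymatroid S1 \<phi>1" and "polymatroid S2 \<phi>2"
  shows
    "(CHAR('f2::division_ring) = 2 \<and>
        (\<exists>k::nat. 0 < k \<and>
           representable_over TYPE('f2) TYPE('v2::ab_group_add) S2 (\<lambda>X. real k * \<phi>2 X))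
       \<longrightarrow> (\<forall>B. (\<forall>i\<in>{1..7}. B i \<subseteq> S2) \<longrightarrow> char_2_inequality \<phi>2 B)) \<and>
     (\<forall>indep t. non_fano_matroid S2 indep t \<and> (\<forall>X\<subseteq>S2. \<phi>2 X = real (matroid_rank indep X))
       \<longrightarrow> \<not> char_2_inequality \<phi>2 (\<lambda>i. {t i})) \<and>
     (CHAR('f1::division_ring) \<noteq> 2 \<and>
        (\<exists>k::nat. 0 < k \<and>
           representable_over TYPE('f1) TYPE('v1::ab_group_add) S1 (\<lambda>X. real k * \<phi>1 X))
       \<longrightarrow> (\<forall>A. (\<forall>i\<in>{1..7}. A i \<subseteq> S1) \<longrightarrow> char_not_2_inequality \<phi>1 A)) \<and>
     (\<forall>indep s. fano_matroid S1 indep s \<and> (\<forall>X\<subseteq>S1. \<phi>1 X = real (matroid_rank indep X))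
       \<longrightarrow> \<not> char_not_2_inequality \<phi>1 (\<lambda>i. {s i}))"
proof (intro conjI impI allI)
  fix B :: "nat \<Rightarrow> 'b set"
  assume rep: "CHAR('f2) = 2 \<and> (\<exists>k::nat. 0 < k \<and>
      representable_over TYPE('f2) TYPE('v2) S2 (\<lambda>X. real k * \<phi>2 X))"
    and B: "\<forall>i\<in>{1..7}. B i \<subseteq> S2"
  then show "char_2_inequality \<phi>2 B"
    using char_2_inequality_of_representable[OF assms(2) _ _ _ B] by blast
next
  fix A :: "nat \<Rightarrow> 'a set"
  assume rep: "CHAR('f1) \<noteq> 2 \<and> (\<exists>k::nat. 0 < k \<and>
      representable_over TYPE('f1) TYPE('v1) S1 (\<lambda>X. real k * \<phi>1 X))"
    and A: "\<forall>i\<in>{1..7}. A i \<subseteq> S1"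
  then show "char_not_2_inequality \<phi>1 A"
    using char_not_2_inequality_of_representable[OF assms(1) _ _ _ A] by blast
qed (use non_fano_violates fano_violates in \<open>metis+\<close>)

end
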